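(* The integrality gap of the Bidirected Cut Relaxation for the Steiner Tree problem is at most $1.898$; that is, for every instance $\mathcal{I}$ of the Steiner Tree problem, $\mathrm{OPT}(\mathcal{I}) \le 1.898\cdot \mathrm{BCR}(\mathcal{I})$.
   Context: An instance $\mathcal{I}=(G,c,R)$ of the Steiner Tree problem consists of a finite connected undirected graph $G=(V,E)$, positive edge costs $c\colon E\to\mathbb{R}_{>0}$, and a nonempty set $R\subseteq V$ of terminals. A Steiner tree is a tree in $G$ containing all terminals; its cost is the sum of its edge costs, and $\mathrm{OPT}(\mathcal{I})$ is the minimum cost of a Steiner tree. Bidirected Cut Relaxation: replace every undirected edge $\{u,v\}$ by the two directed edges $(u,v),(v,u)$, each of cost $c(\{u,v\})$; let $\vec E$ be the resulting edge set. Fix an arbitrary root $r\in R$. For $S\subseteq V$ let $\delta^+(S)=\{(v,w)\in\vec E: v\in S, w\notin S\}$. Then $\mathrm{BCR}(\mathcal{I})$ is the optimum value of the linear program $$\min \sum_{e\in\vec E}c(e)x_e\quad\text{s.t.}\quad \sum_{e\in\delta^+(S)}x_e\ge 1\ \ \forall S\subseteq V\setminus\{r\}\text{ with }S\cap R\ne\emptyset,\qquad x_e\ge 0\ \ \forall e\in\vec E.$$ This value is independent of the choice of $r\in R$. The integrality gap is the supremum of $\mathrm{OPT}(\mathcal{I})/\mathrm{BCR}(\mathcal{I})$ over all instances. *)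

theory Defs
  imports Complex_Main "HOL-Library.Extended_Real"
begin

text \<open>
  Undirected graphs are given by a vertex set and a set of two-element vertex sets.
  (The AFP entry Graph\_Theory models undirected graphs as symmetric digraphs, in which
  every edge already forms a cycle, so its notion of tree is not the undirected one.)
\<close>

definition simple_graph :: "'v set \<Rightarrow> 'v set set \<Rightarrow> bool" where
  "simple_graph V E \<longleftrightarrow>
     finite V \<and> (\<forall>e\<in>E. \<exists>u v. u \<in> V \<and> v \<in> V \<and> u \<noteq> v \<and> e = {u, v})"

definition bidirected :: "'v set set \<Rightarrow> ('v \<times> 'v) set" where
  "bidirected E = {(u, v). {u, v} \<in> E}"

definition connected_graph :: "'v set \<Rightarrow> 'v set set \<Rightarrow> bool" where
  "connected_graph V E \<longleftrightarrow>
     simple_graph V E \<and> V \<noteq> {} \<and> (\<forall>u\<in>V. \<forall>v\<in>V. (u, v) \<in> (bidirected E)\<^sup>*)"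

definition is_cycle :: "'v set set \<Rightarrow> 'v list \<Rightarrow> bool" where
  "is_cycle E vs \<longleftrightarrow>
     length vs \<ge> 3 \<and> distinct vs \<and>
     (\<forall>i<length vs. {vs ! i, vs ! (Suc i mod length vs)} \<in> E)"

definition tree_graph :: "'v set \<Rightarrow> 'v set set \<Rightarrow> bool" where
  "tree_graph V E \<longleftrightarrow> connected_graph V E \<and> (\<nexists>vs. is_cycle E vs)"

locale steiner_instance =
  fixes V :: "'v set" and E :: "'v set set" and c :: "'v set \<Rightarrow> real" and R :: "'v set"
  assumes connected: "connected_graph V E"
    and cost_pos: "e \<in> E \<Longrightarrow> 0 < c e"
    and terminals_subset: "R \<subseteq> V"
    and terminals_nonempty: "R \<noteq> {}"

definition steiner_tree ::
  "'v set \<Rightarrow> 'v set set \<Rightarrow> 'v set \<Rightarrow> 'v set \<Rightarrow> 'v set set \<Rightarrow> bool" where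
  "steiner_tree V E R W T \<longleftrightarrow> W \<subseteq> V \<and> T \<subseteq> E \<and> tree_graph W T \<and> R \<subseteq> W"

definition steiner_opt ::
  "'v set \<Rightarrow> 'v set set \<Rightarrow> ('v set \<Rightarrow> real) \<Rightarrow> 'v set \<Rightarrow> real" where
  "steiner_opt V E c R = Min {sum c T | W T. steiner_tree V E R W T}"

definition out_cut :: "'v set set \<Rightarrow> 'v set \<Rightarrow> ('v \<times> 'v) set" where
  "out_cut E S = {(v, w) \<in> bidirected E. v \<in> S \<and> w \<notin> S}"

definition bcr_feasible ::
  "'v set \<Rightarrow> 'v set set \<Rightarrow> 'v set \<Rightarrow> 'v \<Rightarrow> ('v \<times> 'v \<Rightarrow> real) \<Rightarrow> bool" where
  "bcr_feasible V E R r x \<longleftrightarrow>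
     (\<forall>S. S \<subseteq> V - {r} \<and> S \<inter> R \<noteq> {} \<longrightarrow> (\<Sum>e\<in>out_cut E S. x e) \<ge> 1) \<and>
     (\<forall>e\<in>bidirected E. x e \<ge> 0)"

definition bcr ::
  "'v set \<Rightarrow> 'v set set \<Rightarrow> ('v set \<Rightarrow> real) \<Rightarrow> 'v set \<Rightarrow> 'v \<Rightarrow> real" where
  "bcr V E c R r =
     Inf {(\<Sum>(u, v)\<in>bidirected E. c {u, v} * x (u, v)) | x. bcr_feasible V E R r x}"

text \<open>
  Every finite instance is isomorphic to one whose vertices are natural numbers, so it suffices
  to let those range in the supremum. The value of the relaxation does not depend
  on the root, so all roots in \<open>R\<close> may be included. In the extended reals \<open>0 / 0 = 0\<close> (the case
  of a single terminal), while \<open>a / 0 = \<infinity>\<close> for \<open>a > 0\<close>.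
\<close>
definition bcr_integrality_gap :: ereal where
  "bcr_integrality_gap =
     Sup {ereal (steiner_opt V E c R) / ereal (bcr V E c R r) | (V :: nat set) E c R r.
            steiner_instance V E c R \<and> r \<in> R}"

end

theory Submission
  imports Defs "HOL-Analysis.Analysis"
begin

text \<open>
  By weak duality it suffices to find a feasible dual solution of value \<open>8/15\<close> times the optimum.
  Among all ways to connect the terminals by direct connections and stars with three terminals, take
  one that minimises a potential in which one leg of every star counts \<open>3/2\<close>. It induces a tree of
  weighted links on the terminals whose total weight is at least the optimum. If \<open>D s t\<close> denotes the
  bottleneck weight between two terminals, then by minimality \<open>D s t \<le> d s t\<close>, and
  \<open>D s t + D s j \<le> 3/2 * d v s + d v t + d v j\<close> for every vertex \<open>v\<close> if \<open>D s j \<le> D t j\<close>.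

  The dual solution is a moat growing. At time \<open>\<tau>\<close> the clusters are the classes of \<open>8/15 * D \<le> \<tau>\<close>, and
  the moat of a cluster consists of the vertices \<open>v\<close> that some \<open>s\<close> in the cluster reaches by time
  \<open>\<tau>\<close>, where the arrival time of \<open>s\<close> at \<open>v\<close> is the maximum of \<open>(3 * d s v - d t v + D s t) / 4\<close> over all
  terminals \<open>t\<close>. The inequality for stars implies that at most two clusters that have not yet merged
  meet at a point, and in this case their arrival times add up to \<open>(d s v + d t v + D s t) / 2\<close>, which
  grows at most at unit rate along an edge. Hence no directed edge is overloaded. The root is not
  reached before the merge, and the number of clusters without the root is at least the number of
  links of weight more than \<open>15/8 * \<tau>\<close>, so integrating over \<open>\<tau>\<close> gives the claim.
\<close>

section \<open>Moat growing on an ultrametric\<close>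

lemma finite_obtains_max:
  fixes f :: "'a \<Rightarrow> 'b :: linorder"
  assumes "finite X" "X \<noteq> {}"
  obtains x where "x \<in> X" "\<And>y. y \<in> X \<Longrightarrow> f y \<le> f x"
proof -
  have "Max (f ` X) \<in> f ` X" using assms by (intro Max_in) auto
  then obtain x where "x \<in> X" "Max (f ` X) = f x" by auto
  then show thesis using that[of x] assms Max_ge[of "f ` X"] by simp
qed

locale terminal_ultrametric =
  fixes R :: "'v set" and D :: "'v \<Rightarrow> 'v \<Rightarrow> real"
  assumes finite_R: "finite R"
    and D_self: "s \<in> R \<Longrightarrow> D s s = 0"
    and D_sym: "s \<in> R \<Longrightarrow> t \<in> R \<Longrightarrow> D s t = D t s"
    and D_ultra: "s \<in> R \<Longrightarrow> t \<in> R \<Longrightarrow> j \<in> R \<Longrightarrow> D s t \<le> max (D s j) (D j t)"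
begin

text \<open>\<^term>\<open>f\<close> stands for the distances of a point of the graph to the terminals; the condition
  says that a star centred at this point does not improve the links of weight \<^term>\<open>D\<close>.\<close>
definition admissible :: "('v \<Rightarrow> real) \<Rightarrow> bool" where
  "admissible f \<longleftrightarrow>
     (\<forall>s\<in>R. \<forall>t\<in>R. \<forall>j\<in>R. D s j \<le> D t j \<longrightarrow> D s t + D s j \<le> 3/2 * f s + f t + f j)"

text \<open>In the zone where the moats of \<open>s\<close> and \<open>t\<close> both advance in the same direction, \<open>f s\<close> and
  \<open>f t\<close> grow at unit rate, so each of \<open>(3 * f s - f t + D s t) / 4\<close> and \<open>(3 * f t - f s + D s t) / 4\<close>
  grows at rate \<open>1/2\<close> and the edge is not overloaded. On a path of length \<open>D s t\<close> from \<open>s\<close>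
  to \<open>t\<close> the first one equals \<open>f s\<close>. The maximum over \<open>t\<close> singles out the active conflict.\<close>
definition arrival :: "('v \<Rightarrow> real) \<Rightarrow> 'v \<Rightarrow> real" where
  "arrival f s = Max ((\<lambda>t. (3 * f s - f t + D s t) / 4) ` R)"

lemma arrival_ge: "t \<in> R \<Longrightarrow> (3 * f s - f t + D s t) / 4 \<le> arrival f s"
  unfolding arrival_def using finite_R by (intro Max_ge) auto

lemma arrival_le:
  assumes "s \<in> R" "\<And>t. t \<in> R \<Longrightarrow> (3 * f s - f t + D s t) / 4 \<le> x"
  shows "arrival f s \<le> x"
  unfolding arrival_def using finite_R assms by (subst Max_le_iff) auto

text \<open>The coefficients \<open>3/4\<close> and \<open>-1/4\<close> of the two distances have
  absolute values adding up to 1, so each term of the maximum shifts by at most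
  \<open>e\<close>.\<close>

lemma arrival_lipschitz:
  assumes "s \<in> R" "\<And>t. t \<in> R \<Longrightarrow> \<bar>f t - g t\<bar> \<le> e"
  shows "arrival f s \<le> arrival g s + e"
proof (rule arrival_le[OF assms(1)])
  fix t assume "t \<in> R"
  then show "(3 * f s - f t + D s t) / 4 \<le> arrival g s + e"
    using arrival_ge[of t g s] assms(2)[of t] assms(2)[of s] assms(1) by (simp add: abs_le_iff field_simps)
qed

text \<open>Two terminals at distance \<open>D\<close> merge at time \<open>8/15 * D\<close>; the factor \<open>1/2\<close> would give the
  classical bound 2. Everything below works for factors less than \<open>15/28\<close>, where
  \<open>7/2 * (2 * factor - 1/2) = 2\<close>.\<close>
definition separated :: "('v \<Rightarrow> real) \<Rightarrow> 'v \<Rightarrow> 'v \<Rightarrow> bool" where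
  "separated f s t \<longleftrightarrow> 0 < D s t \<and> arrival f s \<le> 8/15 * D s t \<and> arrival f t \<le> 8/15 * D s t"

lemma separated_sym: "s \<in> R \<Longrightarrow> t \<in> R \<Longrightarrow> separated f s t \<Longrightarrow> separated f t s"
  unfolding separated_def using D_sym by simp

text \<open>Three times the bound for \<open>s\<close> plus the bound for \<open>t\<close> cancels
  \<open>f t\<close>; what remains has the coefficient
  \<open>2 * 8/15 - 1/2 = 17/30\<close>.\<close>

lemma separated_close:
  assumes "s \<in> R" "t \<in> R" "separated f s t"
  shows "f s \<le> 17/30 * D s t" "f t \<le> 17/30 * D s t"
proof -
  have "3 * f s - f t + D s t \<le> 32/15 * D s t" "3 * f t - f s + D s t \<le> 32/15 * D s t"
    using assms arrival_ge[of t f s] arrival_ge[of s f t] D_sym[of s t]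
    unfolding separated_def by auto
  then show "f s \<le> 17/30 * D s t" "f t \<le> 17/30 * D s t" by argo+
qed

text \<open>Since \<open>s\<close>, \<open>t\<close> is the closest pair,
  \<open>D s j = D t j\<close> and the star condition applies with \<open>s\<close> as the expensive
  leg. By \<open>separated_close\<close> its right side is at most
  \<open>17/12 * D s t + 17/30 * D s j\<close>, which is too small because
  \<open>D s t \<le> D s j\<close>.\<close>

lemma no_three_separated_aux:
  assumes f: "admissible f" and R: "s \<in> R" "t \<in> R" "j \<in> R"
    and sep: "separated f s t" "separated f s j" "separated f t j"
    and min: "D s t \<le> D s j" "D s t \<le> D t j"
  shows False
proof -
  have eq: "D s j = D t j"
    using D_ultra[of s j t] D_ultra[of t j s] min D_sym[of s t] R by (auto simp: max_def split: if_splits)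
  then have "D s t + D s j \<le> 3/2 * f s + f t + f j"
    using f R unfolding admissible_def by (metis order_refl)
  moreover have "f s \<le> 17/30 * D s t" "f t \<le> 17/30 * D s t" "f j \<le> 17/30 * D s j" "0 < D s t"
    using separated_close R sep unfolding separated_def by blast+
  ultimately show False using min by argo
qed

lemma no_three_separated:
  assumes f: "admissible f" and R: "s \<in> R" "t \<in> R" "j \<in> R"
    and sep: "separated f s t" "separated f s j" "separated f t j"
  shows False
proof -
  note sy = separated_sym[OF R(1,2) sep(1)] separated_sym[OF R(1,3) sep(2)] separated_sym[OF R(2,3) sep(3)]
  note D = D_sym[OF R(1,2)] D_sym[OF R(1,3)] D_sym[OF R(2,3)]
  consider "D s t \<le> D s j" "D s t \<le> D t j" | "D s j \<le> D s t" "D s j \<le> D t j" | "D t j \<le> D s t" "D t j \<le> D s j"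
    by argo
  then show False
  proof cases
    case 1 then show ?thesis using no_three_separated_aux[OF f R sep] by simp
  next
    case 2 then show ?thesis using no_three_separated_aux[OF f R(1,3,2) sep(2,1) sy(3)] D by simp
  next
    case 3 then show ?thesis using no_three_separated_aux[OF f R(2,3,1) sep(3) sy(1,2)] D by simp
  qed
qed

section \<open>Clusters, their first arrivals and merge times\<close>

definition cluster :: "'v set \<Rightarrow> bool" where
  "cluster A \<longleftrightarrow> A \<subseteq> R \<and> A \<noteq> {} \<and> (\<forall>s\<in>A. \<forall>t\<in>A. \<forall>j\<in>R - A. D s t < D s j)"

text \<open>In an ultrametric triangle the two longest sides are equal, and here \<open>s t\<close>
  is strictly the shortest side.\<close>

lemma cluster_outside:
  assumes "cluster A" "s \<in> A" "t \<in> A" "j \<in> R - A"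
  shows "D s j = D t j"
proof -
  have "D s t < D s j" "D t s < D t j" "s \<in> R" "t \<in> R" "j \<in> R"
    using assms unfolding cluster_def by blast+
  then show ?thesis
    using D_ultra[of s j t] D_ultra[of t j s] D_sym[of s t] by (auto simp: max_def split: if_splits)
qed

text \<open>Each term for \<open>s\<close> is dominated by a term for \<open>s'\<close>: by that of
  the same \<open>t\<close>, or, if \<open>D s t\<close> exceeds \<open>D s' t\<close>, by the term
  of \<open>s'\<close> against \<open>s\<close>.\<close>

lemma arrival_nearest:
  assumes "cluster A" "s \<in> A" "\<And>t. t \<in> A \<Longrightarrow> f s \<le> f t" "s' \<in> A"
  shows "arrival f s \<le> arrival f s'"
proof (rule arrival_le)
  have sub: "A \<subseteq> R" using assms unfolding cluster_def by blast
  then show "s \<in> R" using assms by blast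
  have s': "f s \<le> f s'" using assms by blast
  fix t assume t: "t \<in> R"
  show "(3 * f s - f t + D s t) / 4 \<le> arrival f s'"
  proof (cases "t \<in> A")
    case True
    have "D s t \<le> max (D s s') (D s' t)" using D_ultra t sub assms by blast
    then consider "D s t \<le> D s' s" | "D s t \<le> D s' t"
      using D_sym[of s s'] sub assms(2,4) by (fastforce simp: max_def split: if_splits)
    then show ?thesis
    proof cases
      case 1
      then show ?thesis using arrival_ge[of s f s'] assms(3)[OF True] s' sub assms by force
    next
      case 2
      then show ?thesis using arrival_ge[of t f s'] s' t by argo
    qed
  next
    case False
    then show ?thesis using arrival_ge[of t f s'] cluster_outside[of A s s' t] assms s' t by force
  qed
qed

definition first_arrival :: "('v \<Rightarrow> real) \<Rightarrow> 'v set \<Rightarrow> real" where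
  "first_arrival f A = Min (arrival f ` A)"

text \<open>The value is meaningful only if \<^term>\<open>A\<close> is not all of \<^term>\<open>R\<close>.\<close>
definition merge_time :: "'v set \<Rightarrow> real" where
  "merge_time A = Min ((\<lambda>(s, j). 8/15 * D s j) ` (A \<times> (R - A)))"

lemma finite_cluster: "cluster A \<Longrightarrow> finite A"
  unfolding cluster_def using finite_R finite_subset by blast

lemma first_arrival_le: "cluster A \<Longrightarrow> s \<in> A \<Longrightarrow> first_arrival f A \<le> arrival f s"
  unfolding first_arrival_def using finite_cluster by simp

lemma first_arrival_ex: "cluster A \<Longrightarrow> \<exists>s\<in>A. first_arrival f A = arrival f s"
proof -
  assume "cluster A"
  then have "Min (arrival f ` A) \<in> arrival f ` A"
    using finite_cluster unfolding cluster_def by (intro Min_in) auto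
  then show ?thesis unfolding first_arrival_def by auto
qed

lemma first_arrival_mono: "cluster A \<Longrightarrow> cluster B \<Longrightarrow> A \<subseteq> B \<Longrightarrow> first_arrival f B \<le> first_arrival f A"
  using first_arrival_ex[of A f] first_arrival_le[of B] by auto

lemma first_arrival_nearest:
  assumes "cluster A" "s \<in> A" "\<And>t. t \<in> A \<Longrightarrow> f s \<le> f t"
  shows "first_arrival f A = arrival f s"
  using first_arrival_ex[OF assms(1), of f] first_arrival_le[OF assms(1,2), of f]
    arrival_nearest[where f = f, OF assms(1,2,3)]
  by force

lemma first_arrival_lipschitz:
  assumes "cluster A" "\<And>t. t \<in> R \<Longrightarrow> \<bar>f t - g t\<bar> \<le> e"
  shows "first_arrival f A \<le> first_arrival g A + e"
proof -
  obtain s where s: "s \<in> A" "first_arrival g A = arrival g s" using first_arrival_ex assms by blast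
  moreover have "s \<in> R" using s assms unfolding cluster_def by blast
  ultimately show ?thesis
    using first_arrival_le[of A s f] arrival_lipschitz[of s f g e] assms by force
qed

lemma first_arrival_cong:
  assumes "cluster A" "\<And>t. t \<in> R \<Longrightarrow> f t = g t"
  shows "first_arrival f A = first_arrival g A"
  using first_arrival_lipschitz[OF assms(1), of f g 0] first_arrival_lipschitz[OF assms(1), of g f 0] assms(2)
  by simp

lemma merge_time_le: "cluster A \<Longrightarrow> s \<in> A \<Longrightarrow> j \<in> R - A \<Longrightarrow> merge_time A \<le> 8/15 * D s j"
  unfolding merge_time_def using finite_cluster[of A] finite_R by (intro Min_le) auto

lemma merge_time_greater:
  assumes "cluster A" "R - A \<noteq> {}" "\<And>s j. s \<in> A \<Longrightarrow> j \<in> R - A \<Longrightarrow> x < 8/15 * D s j"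
  shows "x < merge_time A"
  unfolding merge_time_def using assms finite_cluster[of A] finite_R
  by (subst Min_gr_iff) (auto simp: cluster_def)

text \<open>When the moats of \<open>A\<close> and \<open>B\<close> reach a point before they merge,
  the maximum for the nearest terminal \<open>s\<close> of \<open>A\<close> is attained at the
  nearest terminal \<open>t\<close> of \<open>B\<close>. This removes the maximum, so that the two
  arrival times can be added.\<close>

lemma conflict_arrival:
  assumes f: "admissible f" and cl: "cluster A" "cluster B" and dis: "A \<inter> B = {}"
    and s: "s \<in> A" "\<And>t. t \<in> A \<Longrightarrow> f s \<le> f t" and t: "t \<in> B" "\<And>s. s \<in> B \<Longrightarrow> f t \<le> f s"
    and A: "first_arrival f A \<le> merge_time A" and B: "first_arrival f B \<le> merge_time B"
  shows "arrival f s = (3 * f s - f t + D s t) / 4"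
proof -
  have sub: "A \<subseteq> R" "B \<subseteq> R" using cl unfolding cluster_def by blast+
  have st: "s \<in> R" "t \<in> R" "s \<notin> B" "t \<notin> A" using sub s t dis by auto
  have pos: "0 < D s j" if "j \<in> R - A" for j
    using cl(1) s(1) that D_self[of s] st(1) unfolding cluster_def by force
  have posB: "0 < D t j" if "j \<in> R - B" for j
    using cl(2) t(1) that D_self[of t] st(2) unfolding cluster_def by force
  have ga: "arrival f s \<le> 8/15 * D s j" if "j \<in> R - A" for j
    using A merge_time_le[OF cl(1) s(1) that] first_arrival_nearest[where f = f, OF cl(1) s] by linarith
  have gb: "arrival f t \<le> 8/15 * D t j" if "j \<in> R - B" for j
    using B merge_time_le[OF cl(2) t(1) that] first_arrival_nearest[where f = f, OF cl(2) t] by linarith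
  have sep: "separated f s t"
    unfolding separated_def using pos[of t] ga[of t] gb[of s] D_sym[of s t] st by simp
  have near: "f s \<le> 17/30 * D s t" "f t \<le> 17/30 * D s t" using separated_close sep st by blast+
  have "(3 * f s - f j + D s j) / 4 \<le> (3 * f s - f t + D s t) / 4" if j: "j \<in> R" for j
  proof (cases "D s j \<le> D t j")
    case True
    then have "D s t + D s j \<le> 3/2 * f s + f t + f j"
      using f j st unfolding admissible_def by blast
    \<comment> \<open>By the star condition it suffices that
      \<open>3/2 * f s + 2 * f t \<le> 2 * D s t\<close>, which holds because
      \<open>7/2 * 17/30 < 2\<close>.\<close>
    then show ?thesis using near pos[of t] st by simp
  next
    case False
    have eq: "D s j = D s t"
      using False D_ultra[of s j t] D_ultra[of s t j] D_sym[of j t] j st by (auto simp: max_def split: if_splits)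
    have "f t \<le> f j"
    proof (rule ccontr)
      assume lt: "\<not> f t \<le> f j"
      then have jB: "j \<notin> B" using t(2) by force
      \<comment> \<open>\<open>H\<close> is the largest cluster that contains \<open>t\<close> but
        not \<open>s\<close>. Its terminal \<open>k\<close> nearest to the point would form a
        separated triple with \<open>s\<close> and \<open>t\<close>.\<close>
      define H where "H = {h \<in> R. D t h < D s t}"
      have tj: "t \<in> H" "j \<in> H" using H_def False eq j st D_self pos[of t] by auto
      have clH: "cluster H"
        unfolding cluster_def
      proof (intro conjI ballI)
        show "H \<subseteq> R" "H \<noteq> {}" using H_def tj by blast+
        fix p q k assume "p \<in> H" "q \<in> H" "k \<in> R - H"
        then have h: "p \<in> R" "q \<in> R" "k \<in> R" "D t p < D s t" "D t q < D s t" "D s t \<le> D t k"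
          unfolding H_def by auto
        have "D p q < D s t"
          using D_ultra[of p q t] h D_sym[of p t] st(2) by (auto simp: max_def split: if_splits)
        moreover have "D s t \<le> D p k"
          using D_ultra[of t k p] h st(2) by (auto simp: max_def split: if_splits)
        ultimately show "D p q < D p k" by simp
      qed
      obtain k where k: "k \<in> H" "\<And>h. h \<in> H \<Longrightarrow> f k \<le> f h"
        using ex_is_arg_min_if_finite[of H f] finite_cluster[OF clH] tj unfolding is_arg_min_linorder by auto
      have kt: "f k < f t" using k(2)[OF tj(2)] lt by simp
      have kB: "k \<notin> B" using t(2)[of k] kt by force
      have kR: "k \<in> R" and kD: "D t k < D s t" using k(1) H_def by auto
      have le: "arrival f k \<le> arrival f t" using arrival_nearest[where f = f, OF clH k tj(1)] .
      have Dsk: "D s k = D s t"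
        using kD D_ultra[of s k t] D_ultra[of s t k] D_sym[of k t] kR st by (auto simp: max_def split: if_splits)
      have "separated f t k" unfolding separated_def using posB[of k] gb[of k] le kR kB by simp
      moreover have "separated f s k" using sep le Dsk unfolding separated_def by simp
      ultimately show False using no_three_separated[OF f st(1,2) kR sep] by blast
    qed
    then show ?thesis using eq by simp
  qed
  then have "arrival f s \<le> (3 * f s - f t + D s t) / 4" by (rule arrival_le[OF st(1)])
  then show ?thesis using arrival_ge[of t f s] st by force
qed

text \<open>In the sum of the two formulas of \<open>conflict_arrival\<close> the coefficients
  \<open>3\<close> and \<open>-1\<close> of each distance combine to \<open>2\<close>, over the
  denominator \<open>4\<close>.\<close>

lemma conflict_sum:
  assumes f: "admissible f" and cl: "cluster A" "cluster B" and dis: "A \<inter> B = {}"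
    and A: "first_arrival f A \<le> merge_time A" and B: "first_arrival f B \<le> merge_time B"
    and st: "s \<in> A" "t \<in> B"
  shows "first_arrival f A + first_arrival f B = (Min (f ` A) + Min (f ` B) + D s t) / 2"
proof -
  obtain p where p: "p \<in> A" "\<And>h. h \<in> A \<Longrightarrow> f p \<le> f h"
    using ex_is_arg_min_if_finite[of A f] finite_cluster[OF cl(1)] st unfolding is_arg_min_linorder by auto
  obtain q where q: "q \<in> B" "\<And>h. h \<in> B \<Longrightarrow> f q \<le> f h"
    using ex_is_arg_min_if_finite[of B f] finite_cluster[OF cl(2)] st unfolding is_arg_min_linorder by auto
  have sub: "A \<subseteq> R" "B \<subseteq> R" using cl unfolding cluster_def by blast+
  have "arrival f p = (3 * f p - f q + D p q) / 4"
    using conflict_arrival[OF f cl dis p q A B] .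
  moreover have "arrival f q = (3 * f q - f p + D q p) / 4"
    using conflict_arrival[OF f cl(2,1) _ q p B A] dis by blast
  moreover have "D p q = D q p" using D_sym p q sub by blast
  moreover have "D p q = D s t"
  proof -
    have "D p q = D s q" using cluster_outside[OF cl(1) p(1) st(1)] q dis sub by blast
    moreover have "D q s = D t s" using cluster_outside[OF cl(2) q(1) st(2)] st dis sub by blast
    moreover have "D s q = D q s" "D s t = D t s" using D_sym st q sub by blast+
    ultimately show ?thesis by simp
  qed
  moreover have "Min (f ` A) = f p" using p finite_cluster[OF cl(1)] by (intro Min_eqI) auto
  moreover have "Min (f ` B) = f q" using q finite_cluster[OF cl(2)] by (intro Min_eqI) auto
  moreover have "first_arrival f A = arrival f p" using first_arrival_nearest[where f = f, OF cl(1) p] .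
  moreover have "first_arrival f B = arrival f q" using first_arrival_nearest[where f = f, OF cl(2) q] .
  ultimately show ?thesis by simp
qed


section \<open>The clusters at a fixed time\<close>

definition ball :: "'v \<Rightarrow> real \<Rightarrow> 'v set" where
  "ball s \<tau> = {t \<in> R. 8/15 * D s t \<le> \<tau>}"

lemma ball_sub: "ball s \<tau> \<subseteq> R"
  unfolding ball_def by blast

lemma ball_mono: "\<tau> \<le> \<tau>' \<Longrightarrow> ball s \<tau> \<subseteq> ball s \<tau>'"
  unfolding ball_def by auto

lemma center_in_ball: "s \<in> R \<Longrightarrow> 0 \<le> \<tau> \<Longrightarrow> s \<in> ball s \<tau>"
  unfolding ball_def using D_self by simp

lemma ball_eq:
  assumes "s \<in> R" "t \<in> ball s \<tau>"
  shows "ball t \<tau> = ball s \<tau>"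
proof -
  have t: "t \<in> R" "8/15 * D s t \<le> \<tau>" using assms unfolding ball_def by auto
  have "8/15 * D s j \<le> \<tau> \<longleftrightarrow> 8/15 * D t j \<le> \<tau>" if "j \<in> R" for j
    using D_ultra[of s j t] D_ultra[of t j s] D_sym[of s t] that t assms(1)
    by (auto simp: max_def split: if_splits)
  then show ?thesis unfolding ball_def by blast
qed

lemma cluster_ball:
  assumes "s \<in> R" "0 \<le> \<tau>"
  shows "cluster (ball s \<tau>)"
  unfolding cluster_def
proof (intro conjI ballI)
  show "ball s \<tau> \<subseteq> R" by (rule ball_sub)
  show "ball s \<tau> \<noteq> {}" using center_in_ball assms by blast
  fix p q j assume pqj: "p \<in> ball s \<tau>" "q \<in> ball s \<tau>" "j \<in> R - ball s \<tau>"
  then have "q \<in> ball p \<tau>" "j \<notin> ball p \<tau>" using ball_eq[OF assms(1), of p \<tau>] by auto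
  then show "D p q < D p j" using pqj unfolding ball_def by auto
qed

lemma cluster_R: "s \<in> R \<Longrightarrow> cluster R"
  unfolding cluster_def by auto

text \<open>At time \<open>\<tau>\<close> the moat of the cluster \<^term>\<open>C\<close> contains the point with distances \<^term>\<open>f\<close> but not
  the one with distances \<^term>\<open>g\<close>.\<close>
definition loads :: "('v \<Rightarrow> real) \<Rightarrow> ('v \<Rightarrow> real) \<Rightarrow> real \<Rightarrow> 'v set \<Rightarrow> bool" where
  "loads f g \<tau> C \<longleftrightarrow> C \<in> (\<lambda>s. ball s \<tau>) ` R \<and> first_arrival f C \<le> \<tau> \<and> \<tau> < first_arrival g C"

lemma loads_ball: "loads f g \<tau> C \<Longrightarrow> s \<in> C \<Longrightarrow> s \<in> R \<and> C = ball s \<tau>"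
  unfolding loads_def using ball_eq ball_sub by blast

lemma loads_cluster: "loads f g \<tau> C \<Longrightarrow> 0 \<le> \<tau> \<Longrightarrow> cluster C"
  unfolding loads_def using cluster_ball by blast

end

section \<open>Crossings of one edge by the growing moats\<close>

text \<open>The points \<open>F x\<close>, \<open>0 \<le> x \<le> c\<close>, of an edge of cost \<open>c\<close>.\<close>
locale terminal_segment = terminal_ultrametric +
  fixes F :: "real \<Rightarrow> 'a \<Rightarrow> real" and c :: real
  assumes c_nonneg: "0 \<le> c"
    and F_admissible: "0 \<le> x \<Longrightarrow> x \<le> c \<Longrightarrow> admissible (F x)"
    and F_lipschitz: "0 \<le> x \<Longrightarrow> x \<le> y \<Longrightarrow> y \<le> c \<Longrightarrow> t \<in> R \<Longrightarrow> \<bar>F y t - F x t\<bar> \<le> y - x"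
begin

lemma F_first_arrival_lipschitz:
  assumes "cluster A" "0 \<le> x" "x \<le> y" "y \<le> c"
  shows "\<bar>first_arrival (F y) A - first_arrival (F x) A\<bar> \<le> y - x"
  using first_arrival_lipschitz[OF assms(1), of "F x" "F y" "y - x"]
    first_arrival_lipschitz[OF assms(1), of "F y" "F x" "y - x"] F_lipschitz[OF assms(2-4)]
  by (force simp: abs_minus_commute)

lemma continuous_first_arrival:
  assumes "cluster A"
  shows "continuous_on {0..c} (\<lambda>x. first_arrival (F x) A)"
proof -
  have "1-lipschitz_on {0..c} (\<lambda>x. first_arrival (F x) A)"
  proof (rule lipschitz_onI)
    fix x y assume "x \<in> {0..c}" "y \<in> {0..c}"
    then show "dist (first_arrival (F x) A) (first_arrival (F y) A) \<le> 1 * dist x y"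
      using F_first_arrival_lipschitz[OF assms, of x y] F_first_arrival_lipschitz[OF assms, of y x]
      by (cases "x \<le> y") (auto simp: dist_real_def abs_minus_commute)
  qed simp
  then show ?thesis by (rule lipschitz_on_continuous_on)
qed

lemma Min_F_le:
  assumes "cluster A" "0 \<le> x" "x \<le> c"
  shows "Min (F x ` A) \<le> Min (F 0 ` A) + x"
proof -
  have "Min (F 0 ` A) \<in> F 0 ` A"
    using assms finite_cluster unfolding cluster_def by (intro Min_in) auto
  then obtain s where s: "s \<in> A" "Min (F 0 ` A) = F 0 s" by auto
  then have "s \<in> R" using assms unfolding cluster_def by blast
  then have "F x s \<le> F 0 s + x" using F_lipschitz[of 0 x s] assms by (simp add: abs_le_iff)
  moreover have "Min (F x ` A) \<le> F x s" using s finite_cluster assms by simp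
  ultimately show ?thesis using s by simp
qed

text \<open>Each nearest distance grows by at most \<open>x\<close> and enters the sum with factor
  one half. Treating the moats separately would only give \<open>2 * x\<close>, twice what the edge
  can carry.\<close>

lemma conflict_sum_le:
  assumes cl: "cluster A" "cluster B" and dis: "A \<inter> B = {}"
    and 0: "first_arrival (F 0) A \<le> merge_time A" "first_arrival (F 0) B \<le> merge_time B"
    and x: "0 \<le> x" "x \<le> c" "first_arrival (F x) A \<le> merge_time A" "first_arrival (F x) B \<le> merge_time B"
  shows "first_arrival (F x) A + first_arrival (F x) B \<le> first_arrival (F 0) A + first_arrival (F 0) B + x"
proof -
  obtain s t where st: "s \<in> A" "t \<in> B" using cl unfolding cluster_def by blast
  have "first_arrival (F x) A + first_arrival (F x) B = (Min (F x ` A) + Min (F x ` B) + D s t) / 2"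
    using conflict_sum[OF F_admissible cl dis x(3,4) st] x by simp
  moreover have "first_arrival (F 0) A + first_arrival (F 0) B = (Min (F 0 ` A) + Min (F 0 ` B) + D s t) / 2"
    using conflict_sum[OF F_admissible cl dis 0 st] c_nonneg by simp
  moreover have "Min (F x ` A) \<le> Min (F 0 ` A) + x" "Min (F x ` B) \<le> Min (F 0 ` B) + x"
    using Min_F_le cl x by blast+
  ultimately show ?thesis by argo
qed

text \<open>While both moats are active, the two arrival times together advance at most as fast as the
  point on the edge. So consider the point where the first of the two clusters merges: from there
  on the other moat is alone.\<close>
lemma conflict_exit:
  assumes cl: "cluster A" "cluster B" and dis: "A \<inter> B = {}"
    and 0: "first_arrival (F 0) A \<le> merge_time A" "first_arrival (F 0) B \<le> merge_time B"
  obtains "first_arrival (F c) A \<le> merge_time A" "first_arrival (F c) B \<le> merge_time B"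
      "first_arrival (F c) A + first_arrival (F c) B \<le> first_arrival (F 0) A + first_arrival (F 0) B + c"
    | "merge_time B + first_arrival (F c) A \<le> first_arrival (F 0) A + first_arrival (F 0) B + c"
    | "merge_time A + first_arrival (F c) B \<le> first_arrival (F 0) A + first_arrival (F 0) B + c"
proof -
  define h where "h x = max (first_arrival (F x) A - merge_time A) (first_arrival (F x) B - merge_time B)" for x
  show thesis
  proof (cases "h c \<le> 0")
    case True
    then have "first_arrival (F c) A \<le> merge_time A" "first_arrival (F c) B \<le> merge_time B"
      unfolding h_def by auto
    then show ?thesis using that(1) conflict_sum_le[OF cl dis 0 c_nonneg] by simp
  next
    case False
    have "continuous_on {0..c} h" unfolding h_def
      using continuous_first_arrival cl by (intro continuous_intros) auto
    moreover have "h 0 \<le> 0" using 0 unfolding h_def by simp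
    \<comment> \<open>Any zero of \<open>h\<close> serves: there neither moat arrives after its
      merge and one arrives exactly then. On the rest of the edge the Lipschitz bound for the other
      moat suffices.\<close>
    ultimately obtain x where x: "0 \<le> x" "x \<le> c" "h x = 0"
      using IVT'[of h 0 0 c] False c_nonneg by (meson less_eq_real_def not_le)
    then have le: "first_arrival (F x) A \<le> merge_time A" "first_arrival (F x) B \<le> merge_time B"
      and eq: "first_arrival (F x) A = merge_time A \<or> first_arrival (F x) B = merge_time B"
      unfolding h_def by (auto simp: max_def split: if_splits)
    have "first_arrival (F x) A + first_arrival (F x) B \<le> first_arrival (F 0) A + first_arrival (F 0) B + x"
      by (rule conflict_sum_le[OF cl dis 0 x(1,2) le])
    moreover have "first_arrival (F c) A \<le> first_arrival (F x) A + (c - x)"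
      "first_arrival (F c) B \<le> first_arrival (F x) B + (c - x)"
      using F_first_arrival_lipschitz[OF cl(1) x(1,2)] F_first_arrival_lipschitz[OF cl(2) x(1,2)]
      by (simp_all add: abs_le_iff)
    ultimately show ?thesis using eq that(2,3) by argo
  qed
qed

text \<open>This is the capacity constraint of the dual solution for one directed edge. The crossing
  moats are those around the terminal \<open>s\<close> nearest to the start of the edge, and those
  avoiding \<open>s\<close>; both kinds are controlled by one maximal cluster each.\<close>

lemma load_bound:
  obtains l1 h1 l2 h2 where "l1 \<le> h1" "l2 \<le> h2" "(h1 - l1) + (h2 - l2) \<le> c"
    "\<And>\<tau>. 0 \<le> \<tau> \<Longrightarrow> real (card {C. loads (F 0) (F c) \<tau> C}) \<le> indicator {l1..<h1} \<tau> + indicator {l2..<h2} \<tau>"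
proof (cases "R = {}")
  case True
  then have "{C. loads (F 0) (F c) \<tau> C} = {}" for \<tau> unfolding loads_def by simp
  then show ?thesis using that[of 0 0 0 0] c_nonneg by simp
next
  case False
  note main = that
  let ?L = "loads (F 0) (F c)"
  have adm: "admissible (F 0)" using F_admissible c_nonneg by simp
  obtain s where s: "s \<in> R" "\<And>t. t \<in> R \<Longrightarrow> F 0 s \<le> F 0 t"
    using ex_is_arg_min_if_finite[OF finite_R False, of "F 0"] unfolding is_arg_min_linorder by auto
  have s_first: "arrival (F 0) s \<le> arrival (F 0) t" if "t \<in> R" for t
    using arrival_nearest[where f = "F 0", OF cluster_R[OF s(1)] s that] .
  have fa_s: "first_arrival (F 0) C = arrival (F 0) s" if "cluster C" "s \<in> C" for C
    using first_arrival_nearest[where f = "F 0", OF that] s that unfolding cluster_def by blast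
  \<comment> \<open>Otherwise \<open>s\<close> and the terminals \<open>s1\<close>,
    \<open>s2\<close> that arrive first would be pairwise separated at the start of the edge. In
    particular, at each time at most one crossing moat avoids \<open>s\<close>.\<close>
  have chain: "C1 \<subseteq> C2"
    if L: "?L \<tau>1 C1" "?L \<tau>2 C2" "0 \<le> \<tau>1" "\<tau>1 \<le> \<tau>2" "s \<notin> C1" "s \<notin> C2" for C1 C2 \<tau>1 \<tau>2
  proof -
    have cl: "cluster C1" "cluster C2" using loads_cluster L by force+
    obtain s1 where s1: "s1 \<in> C1" "arrival (F 0) s1 \<le> \<tau>1"
      using first_arrival_ex[OF cl(1), of "F 0"] L(1) unfolding loads_def by auto
    obtain s2 where s2: "s2 \<in> C2" "arrival (F 0) s2 \<le> \<tau>2"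
      using first_arrival_ex[OF cl(2), of "F 0"] L(2) unfolding loads_def by auto
    note b = loads_ball[OF L(1) s1(1)] loads_ball[OF L(2) s2(1)]
    show ?thesis
    proof (cases "s1 \<in> C2")
      case True
      then show ?thesis using loads_ball[OF L(2)] b(1) ball_mono[OF L(4)] by blast
    next
      case False
      have "\<tau>1 < 8/15 * D s1 s" "\<tau>2 < 8/15 * D s2 s" "\<tau>2 < 8/15 * D s2 s1"
        using b L(5,6) False s(1) unfolding ball_def by auto
      then have "separated (F 0) s1 s" "separated (F 0) s2 s" "separated (F 0) s2 s1"
        unfolding separated_def using s1 s2 s_first[of s1] s_first[of s2] b L(3,4) by auto
      then show ?thesis using no_three_separated[OF adm, of s2 s1 s] b s(1) by blast
    qed
  qed
  define I where "I \<tau> \<longleftrightarrow> ?L \<tau> (ball s \<tau>)" for \<tau>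
  define J where "J \<tau> \<longleftrightarrow> (\<exists>C. ?L \<tau> C \<and> s \<notin> C)" for \<tau>
  have card_le: "real (card {C. ?L \<tau> C}) \<le> of_bool (I \<tau>) + of_bool (J \<tau>)" if "0 \<le> \<tau>" for \<tau>
  proof -
    have fin: "finite {C. ?L \<tau> C}" unfolding loads_def using finite_R by simp
    have "{C. ?L \<tau> C} = {C. ?L \<tau> C \<and> s \<in> C} \<union> {C. ?L \<tau> C \<and> s \<notin> C}" by blast
    then have "card {C. ?L \<tau> C} \<le> card {C. ?L \<tau> C \<and> s \<in> C} + card {C. ?L \<tau> C \<and> s \<notin> C}"
      by (metis card_Un_le)
    moreover have "card {C. ?L \<tau> C \<and> s \<in> C} \<le> of_bool (I \<tau>)"
    proof -
      have "{C. ?L \<tau> C \<and> s \<in> C} \<subseteq> (if I \<tau> then {ball s \<tau>} else {})"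
        unfolding I_def using loads_ball by auto
      from card_mono[OF _ this] show ?thesis by (auto split: if_splits)
    qed
    moreover have "card {C. ?L \<tau> C \<and> s \<notin> C} \<le> of_bool (J \<tau>)"
    proof (cases "J \<tau>")
      case True
      then obtain C where "?L \<tau> C" "s \<notin> C" unfolding J_def by blast
      then have "{C. ?L \<tau> C \<and> s \<notin> C} \<subseteq> {C}" using chain that by blast
      from card_mono[OF _ this] show ?thesis using True by simp
    next
      case False
      then have "{C. ?L \<tau> C \<and> s \<notin> C} = {}" unfolding J_def by blast
      then show ?thesis using False by (metis card.empty le0)
    qed
    ultimately have "card {C. ?L \<tau> C} \<le> of_bool (I \<tau>) + of_bool (J \<tau>)" by linarith
    then have "real (card {C. ?L \<tau> C}) \<le> real (of_bool (I \<tau>) + of_bool (J \<tau>))" by (rule of_nat_mono)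
    then show ?thesis by simp
  qed
  have I_lower: "arrival (F 0) s \<le> \<tau>" if "I \<tau>" "0 \<le> \<tau>" for \<tau>
    using that fa_s[of "ball s \<tau>"] cluster_ball[OF s(1) that(2)] center_in_ball[OF s(1) that(2)]
    unfolding I_def loads_def by simp
  \<comment> \<open>It is left open which interval serves which moat, since a late moat around
    \<open>s\<close> may be charged to the interval of a cluster avoiding \<open>s\<close>.\<close>
  have bound: thesis
    if "l1 \<le> h1" "l2 \<le> h2" "(h1 - l1) + (h2 - l2) \<le> c"
      "\<And>\<tau>. 0 \<le> \<tau> \<Longrightarrow> I \<tau> \<Longrightarrow> J \<tau> \<Longrightarrow> \<tau> \<in> {l1..<h1} \<and> \<tau> \<in> {l2..<h2}"
      "\<And>\<tau>. 0 \<le> \<tau> \<Longrightarrow> I \<tau> \<or> J \<tau> \<Longrightarrow> \<tau> \<in> {l1..<h1} \<or> \<tau> \<in> {l2..<h2}" for l1 h1 l2 h2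
  proof (rule main[OF that(1-3)])
    fix \<tau> :: real assume "0 \<le> \<tau>"
    then show "real (card {C. ?L \<tau> C}) \<le> indicator {l1..<h1} \<tau> + indicator {l2..<h2} \<tau>"
      using card_le[of \<tau>] that(4)[of \<tau>] that(5)[of \<tau>] 
      by (cases "I \<tau>"; cases "J \<tau>") (auto simp: indicator_def split: if_splits)
  qed
  show ?thesis
  proof (cases "\<exists>\<tau>\<ge>0. J \<tau>")
    case False
    have "\<tau> < arrival (F 0) s + c" if "I \<tau>" "0 \<le> \<tau>" for \<tau>
      using that first_arrival_le[OF cluster_ball[OF s(1) that(2)] center_in_ball[OF s(1) that(2)], of "F c"]
        arrival_lipschitz[OF s(1), of "F c" "F 0" c] F_lipschitz[of 0 c] c_nonneg
      unfolding I_def loads_def by force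
    then show ?thesis
      using False I_lower c_nonneg by (intro bound[of "arrival (F 0) s" "arrival (F 0) s + c" 0 0]) auto
  next
    case True
    define JJ where "JJ = {C. \<exists>\<tau>\<ge>0. ?L \<tau> C \<and> s \<notin> C}"
    have "JJ \<subseteq> Pow R" unfolding JJ_def loads_def ball_def by blast
    then have fJ: "finite JJ" using finite_R finite_subset by blast
    have "JJ \<noteq> {}" using True unfolding JJ_def J_def by blast
    \<comment> \<open>By \<open>chain\<close>, this cluster of maximal cardinality contains all
      others in \<open>JJ\<close>, so every crossing that avoids \<open>s\<close> happens between
      the first arrival of \<open>B\<close> and its merge.\<close>
    then obtain B where B: "B \<in> JJ" "\<And>C. C \<in> JJ \<Longrightarrow> card C \<le> card B"
      using fJ finite_obtains_max[of JJ card] by blast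
    obtain \<tau>B where tB: "0 \<le> \<tau>B" "?L \<tau>B B" and sB: "s \<notin> B" using B(1) unfolding JJ_def by blast
    have clB: "cluster B" using loads_cluster tB by blast
    have J_B: "first_arrival (F 0) B \<le> \<tau> \<and> (\<exists>\<tau>'\<ge>\<tau>. ?L \<tau>' B)" if "J \<tau>" "0 \<le> \<tau>" for \<tau>
    proof -
      obtain C where C: "?L \<tau> C" "s \<notin> C" using \<open>J \<tau>\<close> unfolding J_def by blast
      then have CJ: "C \<in> JJ" using that unfolding JJ_def by blast
      have clC: "cluster C" using loads_cluster C that by blast
      have "C \<subseteq> B \<and> (\<exists>\<tau>'\<ge>\<tau>. ?L \<tau>' B)"
      proof (cases "\<tau> \<le> \<tau>B")
        case True
        then show ?thesis using chain[OF C(1) tB(2) that(2) True C(2) sB] tB by blast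
      next
        case False
        then have "B \<subseteq> C" using chain[OF tB(2) C(1) tB(1) _ sB C(2)] by simp
        then have "B = C" using card_seteq[OF finite_cluster[OF clC], of B] B(2)[OF CJ] by blast
        then show ?thesis using C by blast
      qed
      then show ?thesis using first_arrival_mono[OF clC clB, of "F 0"] C(1) unfolding loads_def by force
    qed
    have loads_merge: "\<tau> < merge_time C" if "?L \<tau> C" "0 \<le> \<tau>" "R - C \<noteq> {}" for C \<tau>
    proof (rule merge_time_greater)
      show "cluster C" using loads_cluster that by blast
      fix p j assume "p \<in> C" "j \<in> R - C"
      then show "\<tau> < 8/15 * D p j" using loads_ball[OF that(1)] unfolding ball_def by force
    qed (rule that)
    obtain t where t: "t \<in> B" "t \<in> R" using clB unfolding cluster_def by blast
    \<comment> \<open>At time \<open>m\<close> the cluster of \<open>s\<close> absorbs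
      \<open>B\<close>. From then on no crossing moat avoids \<open>s\<close>, and a crossing by the
      moat around \<open>s\<close> lies in the interval of \<open>B\<close>.\<close>
    define m where "m = 8/15 * D s t"
    have mB: "merge_time B \<le> m"
      using merge_time_le[OF clB t(1), of s] s(1) sB D_sym[of s t] t unfolding m_def by simp
    have J_upper: "\<tau> < merge_time B" "\<tau> < first_arrival (F c) B" if J: "J \<tau>" "0 \<le> \<tau>" for \<tau>
    proof -
      obtain \<tau>' where L': "?L \<tau>' B" "\<tau> \<le> \<tau>'" using J_B J by blast
      then show "\<tau> < merge_time B" "\<tau> < first_arrival (F c) B"
        using loads_merge[OF L'(1)] J(2) s(1) sB unfolding loads_def by force+
    qed
    have B0: "first_arrival (F 0) B \<le> \<tau>B" "\<tau>B < merge_time B" "\<tau>B < first_arrival (F c) B"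
      using tB loads_merge[OF tB(2,1)] s(1) sB unfolding loads_def by blast+
    have late: "B \<subseteq> ball s \<tau>" if "m \<le> \<tau>" for \<tau>
    proof -
      have "t \<in> ball s \<tau>" using that t unfolding ball_def m_def by simp
      then have "ball t \<tau> = ball s \<tau>" using ball_eq s(1) by blast
      moreover have "B = ball t \<tau>B" using loads_ball tB t by blast
      ultimately show ?thesis using ball_mono[of \<tau>B \<tau> t] B0 mB that by force
    qed
    have I_late: "first_arrival (F 0) B \<le> \<tau>" "\<tau> < first_arrival (F c) B" "\<not> J \<tau>"
      if I: "I \<tau>" "0 \<le> \<tau>" "m \<le> \<tau>" for \<tau>
    proof -
      show "first_arrival (F 0) B \<le> \<tau>" using B0 mB I by linarith
      show "\<tau> < first_arrival (F c) B"
        using first_arrival_mono[OF clB cluster_ball[OF s(1) I(2)] late[OF I(3)], of "F c"] I(1)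
        unfolding I_def loads_def by linarith
      show "\<not> J \<tau>" using J_upper mB I by fastforce
    qed
    have lipB: "first_arrival (F c) B \<le> first_arrival (F 0) B + c"
      using F_first_arrival_lipschitz[OF clB, of 0 c] c_nonneg by (simp add: abs_le_iff)
    show ?thesis
    proof (cases "\<exists>\<tau>\<ge>0. I \<tau> \<and> \<tau> < m")
      \<comment> \<open>Here both kinds of crossings, which never coincide, fit into the single
        interval of \<open>B\<close>.\<close>
      case False
      then have late': "m \<le> \<tau>" if "I \<tau>" "0 \<le> \<tau>" for \<tau> using that by force
      show ?thesis
        using c_nonneg lipB J_B J_upper I_late late'
        by (intro bound[of "first_arrival (F 0) B" "first_arrival (F 0) B + c" 0 0]) fastforce+
    next
      case True
      define II where "II = {ball s \<tau> | \<tau>. 0 \<le> \<tau> \<and> I \<tau> \<and> \<tau> < m}"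
      have "II \<subseteq> Pow R" unfolding II_def ball_def by blast
      then have "finite II" using finite_R finite_subset by blast
      moreover have "II \<noteq> {}" using True unfolding II_def by blast
      \<comment> \<open>\<open>A\<close> is the counterpart of \<open>B\<close> for the moats around
        \<open>s\<close>: by maximality every such crossing before \<open>m\<close> precedes the
        merge of \<open>A\<close>.\<close>
      ultimately obtain A where A: "A \<in> II" "\<And>C. C \<in> II \<Longrightarrow> card C \<le> card A"
        using finite_obtains_max[of II card] by blast
      obtain \<tau>A where tA: "0 \<le> \<tau>A" "?L \<tau>A A" "A = ball s \<tau>A" "\<tau>A < m"
        using A(1) unfolding II_def I_def by blast
      have clA: "cluster A" using loads_cluster tA by blast
      have sA: "s \<in> A" using tA center_in_ball s(1) by blast
      have tnA: "t \<in> R - A" using tA t unfolding ball_def m_def by simp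
      have dis: "A \<inter> B = {}"
      proof (rule ccontr)
        assume "A \<inter> B \<noteq> {}"
        then obtain p where p: "p \<in> A" "p \<in> B" by blast
        have "8/15 * D s p \<le> \<tau>A" using p tA unfolding ball_def by simp
        moreover have "8/15 * D p t \<le> \<tau>B" "p \<in> R" using loads_ball[OF tB(2) p(2)] t unfolding ball_def by auto
        ultimately show False
          using D_ultra[of s t p] s(1) t(2) tA(4) B0 mB unfolding m_def by (auto simp: max_def split: if_splits)
      qed
      have mA: "merge_time A \<le> m" using merge_time_le[OF clA sA tnA] unfolding m_def .
      have A0: "first_arrival (F 0) A \<le> \<tau>A" "\<tau>A < merge_time A" "\<tau>A < first_arrival (F c) A"
        using tA loads_merge[OF tA(2,1)] tnA unfolding loads_def by blast+
      have I_early: "\<tau> < merge_time A \<and> \<tau> < first_arrival (F c) A" if I: "I \<tau>" "0 \<le> \<tau>" "\<tau> < m" for \<tau>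
      proof (cases "\<tau> \<le> \<tau>A")
        case True
        then show ?thesis using A0 by linarith
      next
        case False
        have "ball s \<tau> \<in> II" using I unfolding II_def by blast
        then have "card (ball s \<tau>) \<le> card A" by (rule A(2))
        moreover have "A \<subseteq> ball s \<tau>" using tA(3) ball_mono[of \<tau>A \<tau> s] False by simp
        ultimately have "A = ball s \<tau>"
          using card_seteq[of "ball s \<tau>" A] finite_cluster[OF cluster_ball[OF s(1) I(2)]] by blast
        then have "?L \<tau> A" using I unfolding I_def by simp
        then show ?thesis using loads_merge[of \<tau> A] I(2) tnA unfolding loads_def by blast
      qed
      have I_lo: "first_arrival (F 0) A \<le> \<tau>" if "I \<tau>" "0 \<le> \<tau>" for \<tau>
        using I_lower[OF that] fa_s[OF clA sA] by simp
      have I_up: "\<tau> < first_arrival (F c) A" if I: "I \<tau>" "0 \<le> \<tau>" for \<tau>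
      proof (cases "\<tau> < m")
        case True then show ?thesis using I_early I by blast
      next
        case False
        then have "A \<subseteq> ball s \<tau>" using tA ball_mono[of \<tau>A \<tau> s] by simp
        from first_arrival_mono[OF clA cluster_ball[OF s(1) I(2)] this, of "F c"]
        show ?thesis using I(1) unfolding I_def loads_def by linarith
      qed
      have le: "first_arrival (F 0) A \<le> merge_time A" "first_arrival (F 0) B \<le> merge_time B" using A0 B0 by auto
      show ?thesis
      proof (rule conflict_exit[OF clA clB dis le])
        assume h: "first_arrival (F c) A \<le> merge_time A" "first_arrival (F c) B \<le> merge_time B"
          "first_arrival (F c) A + first_arrival (F c) B \<le> first_arrival (F 0) A + first_arrival (F 0) B + c"
        show ?thesis
          using h A0 B0 I_lo I_up J_B J_upper
          by (intro bound[of "first_arrival (F 0) A" "first_arrival (F c) A"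
                "first_arrival (F 0) B" "first_arrival (F c) B"]) fastforce+
      next
        assume h: "merge_time B + first_arrival (F c) A \<le> first_arrival (F 0) A + first_arrival (F 0) B + c"
        show ?thesis
          using h A0 B0 I_lo I_up J_B J_upper
          by (intro bound[of "first_arrival (F 0) A" "first_arrival (F c) A"
                "first_arrival (F 0) B" "merge_time B"]) fastforce+
      next
        \<comment> \<open>The interval of \<open>A\<close> now stops at its merge, so crossings
          around \<open>s\<close> from time \<open>m\<close> on are charged to the interval of
          \<open>B\<close>.\<close>
        assume h: "merge_time A + first_arrival (F c) B \<le> first_arrival (F 0) A + first_arrival (F 0) B + c"
        have early: "\<tau> \<in> {first_arrival (F 0) A..<merge_time A}" if "I \<tau>" "0 \<le> \<tau>" "\<tau> < m" for \<tau>
          using I_lo I_early that by simp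
        show ?thesis
        proof (rule bound[of "first_arrival (F 0) A" "merge_time A"
                "first_arrival (F 0) B" "first_arrival (F c) B"])
          fix \<tau> :: real assume t0: "0 \<le> \<tau>"
          { assume "I \<tau>" "J \<tau>"
            then have "\<tau> < m" using I_late(3)[of \<tau>] t0 by force
            then show "\<tau> \<in> {first_arrival (F 0) A..<merge_time A} \<and>
                \<tau> \<in> {first_arrival (F 0) B..<first_arrival (F c) B}"
              using early J_B J_upper \<open>I \<tau>\<close> \<open>J \<tau>\<close> t0 by auto }
          { assume "I \<tau> \<or> J \<tau>"
            then show "\<tau> \<in> {first_arrival (F 0) A..<merge_time A} \<or>
                \<tau> \<in> {first_arrival (F 0) B..<first_arrival (F c) B}"
              using early J_B J_upper I_late t0 by (cases "\<tau> < m") auto }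
        qed (use h A0 B0 in linarith)+
      qed
    qed
  qed
qed

end

section \<open>Distances and Steiner trees\<close>

lemma bidirected_sym: "(u, v) \<in> (bidirected P)\<^sup>* \<Longrightarrow> (v, u) \<in> (bidirected P)\<^sup>*"
proof (induction rule: rtrancl_induct)
  case (step y z)
  then have "(z, y) \<in> bidirected P" unfolding bidirected_def by (simp add: insert_commute)
  then show ?case using step by (meson converse_rtrancl_into_rtrancl)
qed simp

lemma bidirected_mono: "P \<subseteq> Q \<Longrightarrow> (bidirected P)\<^sup>* \<subseteq> (bidirected Q)\<^sup>*"
  by (rule rtrancl_mono) (auto simp: bidirected_def)

text \<open>The rest of the cycle joins the ends of its closing edge; length at least 3 ensures that
  it does not use this edge itself.\<close>

lemma cycle_edge_redundant:
  assumes "is_cycle P vs"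
  obtains e where "e \<in> P" "(bidirected P)\<^sup>* \<subseteq> (bidirected (P - {e}))\<^sup>*"
proof -
  define n where "n = length vs"
  have n: "n \<ge> 3" and dist: "distinct vs" and P: "\<And>i. i < n \<Longrightarrow> {vs ! i, vs ! (Suc i mod n)} \<in> P"
    using assms unfolding is_cycle_def n_def by auto
  have neq: "vs ! j \<noteq> vs ! k" if "j < n" "k < n" "j \<noteq> k" for j k
    using that dist nth_eq_iff_index_eq unfolding n_def by blast
  define e where "e = {vs ! (n - 1), vs ! 0}"
  have "e \<in> P" using P[of "n - 1"] n unfolding e_def by simp
  have step: "(vs ! i, vs ! Suc i) \<in> bidirected (P - {e})" if i: "Suc i < n" for i
  proof -
    have "{vs ! i, vs ! Suc i} \<noteq> e"
    proof
      assume "{vs ! i, vs ! Suc i} = e"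
      then have "(vs ! i = vs ! (n - 1) \<and> vs ! Suc i = vs ! 0) \<or> (vs ! i = vs ! 0 \<and> vs ! Suc i = vs ! (n - 1))"
        unfolding e_def doubleton_eq_iff by blast
      moreover have "vs ! i \<noteq> vs ! (n - 1)" "vs ! Suc i \<noteq> vs ! 0"
        by (rule neq; use i in linarith)+
      moreover have "i = 0" if "vs ! i = vs ! 0" using neq[of i 0] that i by linarith
      moreover have "Suc i = n - 1" if "vs ! Suc i = vs ! (n - 1)" using neq[of "Suc i" "n - 1"] that i by linarith
      ultimately show False using n by force
    qed
    then show ?thesis using P[of i] i unfolding bidirected_def by simp
  qed
  have path: "i < n \<Longrightarrow> (vs ! 0, vs ! i) \<in> (bidirected (P - {e}))\<^sup>*" for i
  proof (induction i)
    case (Suc i)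
    then show ?case using step[of i] by (meson Suc_lessD rtrancl.rtrancl_into_rtrancl)
  qed simp
  have ends: "(vs ! 0, vs ! (n - 1)) \<in> (bidirected (P - {e}))\<^sup>*" using path n by simp
  have "bidirected P \<subseteq> (bidirected (P - {e}))\<^sup>*"
  proof (rule subrelI)
    fix a b assume ab: "(a, b) \<in> bidirected P"
    show "(a, b) \<in> (bidirected (P - {e}))\<^sup>*"
    proof (cases "{a, b} = e")
      case True
      then have "(a = vs ! (n - 1) \<and> b = vs ! 0) \<or> (a = vs ! 0 \<and> b = vs ! (n - 1))"
        unfolding e_def doubleton_eq_iff .
      then show ?thesis using ends bidirected_sym[OF ends] by blast
    next
      case False
      then have "(a, b) \<in> bidirected (P - {e})" using ab unfolding bidirected_def by simp
      then show ?thesis by simp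
    qed
  qed
  then show ?thesis using that[OF \<open>e \<in> P\<close>] rtrancl_subset_rtrancl by blast
qed

lemma sum_Un_le:
  fixes f :: "'a \<Rightarrow> real"
  assumes "finite A" "finite B" "\<And>x. x \<in> A \<union> B \<Longrightarrow> 0 \<le> f x"
  shows "sum f (A \<union> B) \<le> sum f A + sum f B"
  using sum_Un[OF assms(1,2), of f] sum_nonneg[of "A \<inter> B" f] assms(3) by simp

lemma sum_UN_le:
  fixes f :: "'a \<Rightarrow> real"
  assumes "finite S" "\<And>i. i \<in> S \<Longrightarrow> finite (A i)" "\<And>x. x \<in> (\<Union>i\<in>S. A i) \<Longrightarrow> 0 \<le> f x"
  shows "sum f (\<Union>i\<in>S. A i) \<le> (\<Sum>i\<in>S. sum f (A i))"
  using assms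
proof (induction S rule: finite_induct)
  case (insert i S)
  then have "sum f (A i \<union> (\<Union>i\<in>S. A i)) \<le> sum f (A i) + sum f (\<Union>i\<in>S. A i)"
    by (intro sum_Un_le) auto
  then show ?case using insert by auto
qed simp

context steiner_instance
begin

lemma finite_V: "finite V"
  using connected unfolding connected_graph_def simple_graph_def by simp

lemma edge_vertices: "e \<in> E \<Longrightarrow> \<exists>u v. u \<in> V \<and> v \<in> V \<and> u \<noteq> v \<and> e = {u, v}"
  using connected unfolding connected_graph_def simple_graph_def by blast

lemma finite_E: "finite E"
proof (rule finite_subset)
  show "E \<subseteq> Pow V" using edge_vertices by blast
qed (simp add: finite_V)

lemma connected_V: "u \<in> V \<Longrightarrow> v \<in> V \<Longrightarrow> (u, v) \<in> (bidirected E)\<^sup>*"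
  using connected unfolding connected_graph_def by blast

lemma finite_R: "finite R"
  using terminals_subset finite_V finite_subset by blast

lemma bidirected_vertices: "(u, v) \<in> bidirected E \<Longrightarrow> u \<in> V \<and> v \<in> V \<and> u \<noteq> v"
  using edge_vertices[of "{u, v}"] unfolding bidirected_def by (auto simp: doubleton_eq_iff)

lemma sum_cost_mono: "P \<subseteq> Q \<Longrightarrow> Q \<subseteq> E \<Longrightarrow> sum c P \<le> sum c Q"
  using finite_subset[OF _ finite_E] by (intro sum_mono2) (auto intro!: less_imp_le[OF cost_pos])

lemma sum_cost_nonneg: "P \<subseteq> E \<Longrightarrow> 0 \<le> sum c P"
  using cost_pos by (intro sum_nonneg) (auto intro: less_imp_le)

lemma sum_cost_Un: "P \<subseteq> E \<Longrightarrow> Q \<subseteq> E \<Longrightarrow> sum c (P \<union> Q) \<le> sum c P + sum c Q"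
  using finite_subset[OF _ finite_E] by (intro sum_Un_le) (auto intro!: less_imp_le[OF cost_pos])

lemma sum_cost_UN:
  assumes "finite S" "\<And>i. i \<in> S \<Longrightarrow> P i \<subseteq> E"
  shows "sum c (\<Union>i\<in>S. P i) \<le> (\<Sum>i\<in>S. sum c (P i))"
  using assms finite_subset[OF _ finite_E] by (intro sum_UN_le) (auto intro!: less_imp_le[OF cost_pos])

lemma finite_costs: "finite {sum c P | P. P \<subseteq> E \<and> Q P}"
  by (rule finite_subset[of _ "sum c ` Pow E"]) (auto simp: finite_E)

lemma finite_steiner_costs: "finite {sum c T | W T. steiner_tree V E R W T}"
  by (rule finite_subset[of _ "sum c ` Pow E"]) (auto simp: finite_E steiner_tree_def)

text \<open>Take a subset of \<open>P\<close> of least cardinality that still connects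
  \<open>R\<close>: an edge outside the component of a terminal, or on a cycle, could be
  deleted.\<close>

lemma ex_steiner_tree:
  assumes P: "P \<subseteq> E" "\<And>s t. s \<in> R \<Longrightarrow> t \<in> R \<Longrightarrow> (s, t) \<in> (bidirected P)\<^sup>*"
  obtains W T where "steiner_tree V E R W T" "T \<subseteq> P"
proof -
  let ?conn = "\<lambda>T. \<forall>s\<in>R. \<forall>t\<in>R. (s, t) \<in> (bidirected T)\<^sup>*"
  obtain T where T: "T \<subseteq> P" "?conn T" "\<And>T'. T' \<subseteq> P \<and> ?conn T' \<Longrightarrow> card T \<le> card T'"
    using ex_has_least_nat[of "\<lambda>T. T \<subseteq> P \<and> ?conn T" P card] P by blast
  have fT: "finite T" using T(1) P(1) finite_E finite_subset by metis
  have irredundant: "\<not> ?conn (T - {e})" if "e \<in> T" for e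
  proof
    assume "?conn (T - {e})"
    then have "card T \<le> card (T - {e})" using T(1) by (intro T(3)) blast
    then show False using card_Diff1_less[OF fT that] by simp
  qed
  obtain s where s: "s \<in> R" using terminals_nonempty by blast
  define W where "W = {v. (s, v) \<in> (bidirected T)\<^sup>*}"
  have RW: "R \<subseteq> W" using T(2) s unfolding W_def by blast
  have "v \<in> V" if "(s, v) \<in> (bidirected T)\<^sup>*" for v
    using that
  proof (induction rule: rtrancl_induct)
    case base
    then show ?case using s terminals_subset by blast
  next
    case (step y z)
    then have "(y, z) \<in> bidirected E" using T(1) P(1) unfolding bidirected_def by auto
    then show ?case using bidirected_vertices by blast
  qed
  then have WV: "W \<subseteq> V" unfolding W_def by blast
  have TW: "e \<subseteq> W" if e: "e \<in> T" for e
  proof (rule ccontr)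
    assume "\<not> e \<subseteq> W"
    then obtain u where u: "u \<in> e" "u \<notin> W" by blast
    have reach: "(s, v) \<in> (bidirected (T - {e}))\<^sup>*" if "(s, v) \<in> (bidirected T)\<^sup>*" for v
      using that
    proof (induction rule: rtrancl_induct)
      case (step y z)
      have "y \<in> W" "z \<in> W" using step unfolding W_def by (auto intro: rtrancl.rtrancl_into_rtrancl)
      then have "{y, z} \<noteq> e" using u by blast
      then have "(y, z) \<in> bidirected (T - {e})" using step unfolding bidirected_def by simp
      then show ?case using step by simp
    qed simp
    have "?conn (T - {e})"
    proof (intro ballI)
      fix p q assume "p \<in> R" "q \<in> R"
      then have "(s, p) \<in> (bidirected (T - {e}))\<^sup>*" "(s, q) \<in> (bidirected (T - {e}))\<^sup>*"
        using reach RW unfolding W_def by blast+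
      then show "(p, q) \<in> (bidirected (T - {e}))\<^sup>*" using bidirected_sym by (meson rtrancl_trans)
    qed
    then show False using irredundant e by blast
  qed
  have "simple_graph W T"
    unfolding simple_graph_def
  proof (intro conjI ballI)
    show "finite W" using WV finite_V finite_subset by blast
    fix e assume e: "e \<in> T"
    then obtain u v where "u \<noteq> v" "e = {u, v}" using edge_vertices T(1) P(1) by blast
    then show "\<exists>u v. u \<in> W \<and> v \<in> W \<and> u \<noteq> v \<and> e = {u, v}" using TW[OF e] by blast
  qed
  moreover have "(u, v) \<in> (bidirected T)\<^sup>*" if "u \<in> W" "v \<in> W" for u v
  proof -
    have "(s, u) \<in> (bidirected T)\<^sup>*" "(s, v) \<in> (bidirected T)\<^sup>*" using that unfolding W_def by simp_all
    then show ?thesis using bidirected_sym by (meson rtrancl_trans)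
  qed
  ultimately have "connected_graph W T" unfolding connected_graph_def using RW s by blast
  moreover have "\<not> is_cycle T vs" for vs
  proof
    assume "is_cycle T vs"
    then obtain e where "e \<in> T" "(bidirected T)\<^sup>* \<subseteq> (bidirected (T - {e}))\<^sup>*"
      by (rule cycle_edge_redundant)
    then have "?conn (T - {e})" using T(2) by blast
    then show False using irredundant \<open>e \<in> T\<close> by blast
  qed
  ultimately have "steiner_tree V E R W T"
    unfolding steiner_tree_def tree_graph_def using WV RW T(1) P(1) by simp
  then show thesis using that T(1) by simp
qed

lemma steiner_opt_le:
  assumes "P \<subseteq> E" "\<And>s t. s \<in> R \<Longrightarrow> t \<in> R \<Longrightarrow> (s, t) \<in> (bidirected P)\<^sup>*"
  shows "steiner_opt V E c R \<le> sum c P"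
proof -
  obtain W T where T: "steiner_tree V E R W T" "T \<subseteq> P" using ex_steiner_tree assms by blast
  then have "steiner_opt V E c R \<le> sum c T"
    unfolding steiner_opt_def using finite_steiner_costs by (intro Min_le) auto
  then show ?thesis using sum_cost_mono[OF T(2) assms(1)] by simp
qed

lemma steiner_opt_nonneg: "0 \<le> steiner_opt V E c R"
proof -
  have "(s, t) \<in> (bidirected E)\<^sup>*" if "s \<in> R" "t \<in> R" for s t
    using connected_V that terminals_subset by blast
  then obtain W T where "steiner_tree V E R W T" by (rule ex_steiner_tree[OF order_refl])
  then have "{sum c T | W T. steiner_tree V E R W T} \<noteq> {}" by blast
  then have "steiner_opt V E c R \<in> {sum c T | W T. steiner_tree V E R W T}"
    unfolding steiner_opt_def using finite_steiner_costs by (intro Min_in) auto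
  then obtain W T where "steiner_tree V E R W T" "steiner_opt V E c R = sum c T" by blast
  then show ?thesis using sum_cost_nonneg[of T] unfolding steiner_tree_def by simp
qed

text \<open>As costs are positive, the cheapest connecting edge set gives the shortest path
  distance. With sets instead of walks, the triangle inequality is a union bound.\<close>

definition distance :: "'v \<Rightarrow> 'v \<Rightarrow> real" where
  "distance u v = Min {sum c P | P. P \<subseteq> E \<and> (u, v) \<in> (bidirected P)\<^sup>*}"

lemma distance_le: "P \<subseteq> E \<Longrightarrow> (u, v) \<in> (bidirected P)\<^sup>* \<Longrightarrow> distance u v \<le> sum c P"
  unfolding distance_def using finite_costs by (intro Min_le) auto

lemma distance_ex:
  assumes "u \<in> V" "v \<in> V"
  obtains P where "P \<subseteq> E" "(u, v) \<in> (bidirected P)\<^sup>*" "distance u v = sum c P"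
proof -
  let ?X = "{sum c P | P. P \<subseteq> E \<and> (u, v) \<in> (bidirected P)\<^sup>*}"
  have "?X \<noteq> {}" using connected_V[OF assms] by blast
  then have "distance u v \<in> ?X" unfolding distance_def using finite_costs by (intro Min_in) auto
  then show thesis using that by blast
qed

lemma distance_nonneg: "u \<in> V \<Longrightarrow> v \<in> V \<Longrightarrow> 0 \<le> distance u v"
  by (erule distance_ex) (auto simp: sum_cost_nonneg)

lemma distance_pos:
  assumes "u \<in> V" "v \<in> V" "u \<noteq> v"
  shows "0 < distance u v"
proof -
  obtain P where P: "P \<subseteq> E" "(u, v) \<in> (bidirected P)\<^sup>*" "distance u v = sum c P"
    using distance_ex assms by blast
  then have "P \<noteq> {}" using assms(3) by (auto simp: bidirected_def)
  then have "0 < sum c P" using P(1) cost_pos finite_E by (intro sum_pos) (auto intro: finite_subset)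
  then show ?thesis using P by simp
qed

lemma distance_self: "u \<in> V \<Longrightarrow> distance u u = 0"
  using distance_le[of "{}" u u] distance_nonneg[of u u] by simp

lemma distance_sym: "u \<in> V \<Longrightarrow> v \<in> V \<Longrightarrow> distance u v = distance v u"
proof -
  have "distance u v \<le> distance v u" if uv: "u \<in> V" "v \<in> V" for u v
  proof -
    obtain P where P: "P \<subseteq> E" "(v, u) \<in> (bidirected P)\<^sup>*" "distance v u = sum c P"
      using distance_ex uv by blast
    then show ?thesis using distance_le[OF P(1) bidirected_sym[OF P(2)]] by simp
  qed
  then show "u \<in> V \<Longrightarrow> v \<in> V \<Longrightarrow> distance u v = distance v u" by (simp add: order_antisym)
qed

lemma distance_triangle:
  assumes "u \<in> V" "v \<in> V" "w \<in> V"
  shows "distance u w \<le> distance u v + distance v w"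
proof -
  obtain P where P: "P \<subseteq> E" "(u, v) \<in> (bidirected P)\<^sup>*" "distance u v = sum c P"
    using distance_ex assms by blast
  obtain Q where Q: "Q \<subseteq> E" "(v, w) \<in> (bidirected Q)\<^sup>*" "distance v w = sum c Q"
    using distance_ex assms by blast
  have "(u, v) \<in> (bidirected (P \<union> Q))\<^sup>*" "(v, w) \<in> (bidirected (P \<union> Q))\<^sup>*"
    using P(2) Q(2) bidirected_mono[of P "P \<union> Q"] bidirected_mono[of Q "P \<union> Q"] by blast+
  then have "distance u w \<le> sum c (P \<union> Q)" using P Q by (intro distance_le) auto
  then show ?thesis using sum_cost_Un[OF P(1) Q(1)] P Q by simp
qed

lemma distance_edge: "(u, v) \<in> bidirected E \<Longrightarrow> distance u v \<le> c {u, v}"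
  using distance_le[of "{{u, v}}" u v] by (auto simp: bidirected_def)

end

section \<open>Bottlenecks of a tree of links\<close>

text \<open>The equivalence relation generated by \<open>X\<close>; the pairs stand for undirected
  links.\<close>

definition conn :: "('v \<times> 'v) set \<Rightarrow> ('v \<times> 'v) set" where
  "conn X = (X \<union> X\<inverse>)\<^sup>*"

lemma conn_refl [simp]: "(s, s) \<in> conn X"
  unfolding conn_def by simp

lemma conn_trans: "(s, t) \<in> conn X \<Longrightarrow> (t, u) \<in> conn X \<Longrightarrow> (s, u) \<in> conn X"
  unfolding conn_def by (rule rtrancl_trans)

lemma conn_sym: "(s, t) \<in> conn X \<Longrightarrow> (t, s) \<in> conn X"
  unfolding conn_def by (meson sym_Un_converse sym_rtrancl symE)

lemma conn_base: "(s, t) \<in> X \<Longrightarrow> (s, t) \<in> conn X"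
  unfolding conn_def by (intro r_into_rtrancl UnI1)

lemma conn_least: "X \<subseteq> conn Y \<Longrightarrow> conn X \<subseteq> conn Y"
proof -
  assume X: "X \<subseteq> conn Y"
  then have "X \<union> X\<inverse> \<subseteq> conn Y" by (auto intro: conn_sym)
  then show ?thesis unfolding conn_def by (rule rtrancl_subset_rtrancl)
qed

lemma conn_mono: "X \<subseteq> Y \<Longrightarrow> conn X \<subseteq> conn Y"
  by (intro conn_least subrelI conn_base) blast

lemma conn_insert_cases:
  assumes "(s, t) \<in> conn (insert (a, b) X)"
  shows "(s, t) \<in> conn X \<or> (s, a) \<in> conn X \<and> (b, t) \<in> conn X \<or> (s, b) \<in> conn X \<and> (a, t) \<in> conn X"
  using assms unfolding conn_def[of "insert (a, b) X"]
proof (induction rule: rtrancl_induct)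
  case (step y z)
  have "(y = a \<and> z = b) \<or> (y = b \<and> z = a) \<or> (y, z) \<in> conn X"
    using step(2) conn_base[of _ _ X] conn_sym[of z y X] by auto
  then show ?case
  proof (elim disjE conjE)
    assume "y = a" "z = b"
    then show ?thesis using step.IH by (auto intro: conn_trans)
  next
    assume "y = b" "z = a"
    then show ?thesis using step.IH by (auto intro: conn_trans)
  next
    assume "(y, z) \<in> conn X"
    then show ?thesis using step.IH by (auto intro: conn_trans)
  qed
qed simp

lemma conn_insert:
  assumes "(s, t) \<in> conn (insert (a, b) X)" "(s, t) \<notin> conn X"
  shows "(a, b) \<in> conn (insert (s, t) X)"
proof -
  consider "(s, a) \<in> conn X" "(b, t) \<in> conn X" | "(s, b) \<in> conn X" "(a, t) \<in> conn X"
    using conn_insert_cases[OF assms(1)] assms(2) by blast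
  moreover have sub: "conn X \<subseteq> conn (insert (s, t) X)" by (rule conn_mono) blast
  moreover have st: "(s, t) \<in> conn (insert (s, t) X)" by (rule conn_base) blast
  ultimately show ?thesis
  proof cases
    case 1
    then have "(a, s) \<in> conn (insert (s, t) X)" "(t, b) \<in> conn (insert (s, t) X)"
      using sub conn_sym[of s a X] conn_sym[of b t X] by auto
    then show ?thesis by (rule conn_trans[OF _ conn_trans[OF st]])
  next
    case 2
    then have "(s, b) \<in> conn (insert (s, t) X)" "(a, t) \<in> conn (insert (s, t) X)"
      using sub by blast+
    then show ?thesis by (rule conn_trans[OF _ conn_trans[OF conn_sym[OF st]], rotated])
  qed
qed

text \<open>Add the pairs of \<open>G\<close> one by one. The one that first connects
  \<open>s\<close> and \<open>t\<close> can be exchanged for \<open>(s, t)\<close>, and pairs added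
  later do no harm.\<close>

lemma conn_exchange:
  assumes "finite G" "(s, t) \<in> conn (K \<union> p ` G)" "(s, t) \<notin> conn K"
  shows "\<exists>f\<in>G. p f \<in> conn (insert (s, t) (K \<union> p ` (G - {f})))"
  using assms
proof (induction G rule: finite_induct)
  case (insert g G)
  show ?case
  proof (cases "(s, t) \<in> conn (K \<union> p ` G)")
    case True
    then obtain f where f: "f \<in> G" "p f \<in> conn (insert (s, t) (K \<union> p ` (G - {f})))"
      using insert by blast
    moreover have "conn (insert (s, t) (K \<union> p ` (G - {f}))) \<subseteq> conn (insert (s, t) (K \<union> p ` (insert g G - {f})))"
      by (rule conn_mono) blast
    ultimately show ?thesis by blast
  next
    case False
    have "(s, t) \<in> conn (insert (fst (p g), snd (p g)) (K \<union> p ` G))" using insert.prems by simp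
    from conn_insert[OF this False] have "p g \<in> conn (insert (s, t) (K \<union> p ` G))" by simp
    moreover have "insert g G - {g} = G" using insert by blast
    ultimately show ?thesis by (intro bexI[of _ g]) simp_all
  qed
qed simp

text \<open>A link is an edge of a tree on the terminals, \<^term>\<open>p f\<close> are its two ends.\<close>

locale link_tree =
  fixes R :: "'v set" and F :: "'f set" and p :: "'f \<Rightarrow> 'v \<times> 'v" and w :: "'f \<Rightarrow> real"
  assumes finite_R: "finite R" and R_nonempty: "R \<noteq> {}" and finite_F: "finite F"
    and ends: "p ` F \<subseteq> R \<times> R" and w_pos: "f \<in> F \<Longrightarrow> 0 < w f"
    and connects: "R \<times> R \<subseteq> conn (p ` F)"
    and irredundant: "f \<in> F \<Longrightarrow> p f \<notin> conn (p ` (F - {f}))"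
begin

definition below :: "real \<Rightarrow> 'f set" where
  "below \<theta> = {f \<in> F. w f \<le> \<theta>}"

text \<open>The bottleneck: the largest weight on the tree path from \<open>s\<close> to
  \<open>t\<close>. The candidate \<open>0\<close> covers \<open>s = t\<close>.\<close>

definition D :: "'v \<Rightarrow> 'v \<Rightarrow> real" where
  "D s t = Min {\<theta> \<in> insert 0 (w ` F). (s, t) \<in> conn (p ` below \<theta>)}"

lemma below_mono: "x \<le> y \<Longrightarrow> conn (p ` below x) \<subseteq> conn (p ` below y)"
  unfolding below_def by (rule conn_mono) auto

lemma D_in:
  assumes "s \<in> R" "t \<in> R"
  shows "D s t \<in> insert 0 (w ` F)" "(s, t) \<in> conn (p ` below (D s t))"
proof -
  let ?X = "{\<theta> \<in> insert 0 (w ` F). (s, t) \<in> conn (p ` below \<theta>)}"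
  have "below (Max (insert 0 (w ` F))) = F" unfolding below_def using finite_F by auto
  then have "Max (insert 0 (w ` F)) \<in> ?X"
    using connects assms finite_F Max_in[of "insert 0 (w ` F)"] by auto
  then have "D s t \<in> ?X" unfolding D_def using finite_F by (intro Min_in) auto
  then show "D s t \<in> insert 0 (w ` F)" "(s, t) \<in> conn (p ` below (D s t))" by auto
qed

lemma D_nonneg: "s \<in> R \<Longrightarrow> t \<in> R \<Longrightarrow> 0 \<le> D s t"
  using D_in(1)[of s t] w_pos by force

lemma D_le_iff:
  assumes "s \<in> R" "t \<in> R" "0 \<le> \<theta>"
  shows "D s t \<le> \<theta> \<longleftrightarrow> (s, t) \<in> conn (p ` below \<theta>)"
proof
  assume "D s t \<le> \<theta>"
  then show "(s, t) \<in> conn (p ` below \<theta>)" using D_in(2)[OF assms(1,2)] below_mono[of "D s t" \<theta>] by blast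
next
  assume st: "(s, t) \<in> conn (p ` below \<theta>)"
  \<comment> \<open>The set of links up to a threshold changes only at weights, so the threshold is
    rounded down to a candidate in the definition of \<open>D\<close>.\<close>
  define x where "x = Max {y \<in> insert 0 (w ` F). y \<le> \<theta>}"
  have x: "x \<in> {y \<in> insert 0 (w ` F). y \<le> \<theta>}" unfolding x_def
    using finite_F assms(3) by (intro Max_in) auto
  have "below \<theta> \<subseteq> below x" unfolding below_def
  proof safe
    fix f assume "f \<in> F" "w f \<le> \<theta>"
    then show "w f \<le> x" unfolding x_def using finite_F by (intro Max_ge) auto
  qed
  then have "(s, t) \<in> conn (p ` below x)" using st conn_mono[of "p ` below \<theta>" "p ` below x"] by blast
  then have "D s t \<le> x" unfolding D_def using finite_F x by (intro Min_le) auto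
  then show "D s t \<le> \<theta>" using x by simp
qed

lemma D_self: "s \<in> R \<Longrightarrow> D s s = 0"
  using D_le_iff[of s s 0] D_nonneg[of s s] by simp

lemma D_sym:
  assumes "s \<in> R" "t \<in> R"
  shows "D s t = D t s"
proof (rule antisym)
  have le: "D s t \<le> D t s" if "s \<in> R" "t \<in> R" for s t
    using conn_sym[OF D_in(2)[OF that(2,1)]] D_le_iff[OF that D_nonneg[OF that(2,1)]] by simp
  show "D s t \<le> D t s" "D t s \<le> D s t" using le assms by blast+
qed

lemma D_ultra:
  assumes "s \<in> R" "t \<in> R" "j \<in> R"
  shows "D s t \<le> max (D s j) (D j t)"
proof -
  define m where "m = max (D s j) (D j t)"
  have m: "D s j \<le> m" "D j t \<le> m" unfolding m_def by simp_all
  then have "0 \<le> m" using D_nonneg[OF assms(1,3)] by linarith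
  have "(s, j) \<in> conn (p ` below m)" "(j, t) \<in> conn (p ` below m)"
    using m D_le_iff[OF assms(1,3) \<open>0 \<le> m\<close>] D_le_iff[OF assms(3,2) \<open>0 \<le> m\<close>] by simp_all
  then have "(s, t) \<in> conn (p ` below m)" by (rule conn_trans)
  then show ?thesis using D_le_iff[OF assms(1,2) \<open>0 \<le> m\<close>] m_def by simp
qed

lemma not_conn_below:
  assumes "s \<in> R" "t \<in> R" "0 < x" "x \<le> D s t"
  shows "(s, t) \<notin> conn (p ` {f \<in> F. w f < x})"
proof
  assume st: "(s, t) \<in> conn (p ` {f \<in> F. w f < x})"
  define y where "y = Max (insert 0 (w ` {f \<in> F. w f < x}))"
  have "y \<in> insert 0 (w ` {f \<in> F. w f < x})" unfolding y_def using finite_F by (intro Max_in) auto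
  then have y: "0 \<le> y" "y < x" using assms(3) w_pos by force+
  have "{f \<in> F. w f < x} \<subseteq> below y" unfolding below_def y_def
    using finite_F by (auto intro!: Max_ge)
  then have "(s, t) \<in> conn (p ` below y)" using st conn_mono[OF image_mono, of _ _ p] by blast
  then show False using D_le_iff[of s t y] assms y by simp
qed

text \<open>\<open>Z\<close> holds pairs already inserted, so that the exchange can be applied twice.\<close>
lemma heavy_exchange:
  assumes G: "G \<subseteq> F" "R \<times> R \<subseteq> conn (Z \<union> p ` G)" and st: "s \<in> R" "t \<in> R"
    and sep: "(s, t) \<notin> conn (Z \<union> p ` {f \<in> G. w f < x})"
  obtains f where "f \<in> G" "x \<le> w f" "R \<times> R \<subseteq> conn (insert (s, t) (Z \<union> p ` (G - {f})))"
proof -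
  let ?K = "Z \<union> p ` {f \<in> G. w f < x}"
  let ?H = "{f \<in> G. x \<le> w f}"
  have fin: "finite ?H" using finite_subset[OF G(1) finite_F] by simp
  have "G = {f \<in> G. w f < x} \<union> ?H" by auto
  then have "?K \<union> p ` ?H = Z \<union> p ` G" by blast
  then have "(s, t) \<in> conn (?K \<union> p ` ?H)" using G(2) st by auto
  from conn_exchange[OF fin this sep] obtain f where f: "f \<in> ?H"
    "p f \<in> conn (insert (s, t) (?K \<union> p ` (?H - {f})))" by blast
  let ?N = "insert (s, t) (Z \<union> p ` (G - {f}))"
  have "insert (s, t) (?K \<union> p ` (?H - {f})) \<subseteq> ?N" using f(1) by (auto intro: image_eqI)
  then have pf: "p f \<in> conn ?N" using f(2) conn_mono by blast
  have "Z \<union> p ` G \<subseteq> conn ?N"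
  proof
    fix e assume "e \<in> Z \<union> p ` G"
    then have "e = p f \<or> e \<in> ?N" by blast
    then show "e \<in> conn ?N" using pf conn_base[of "fst e" "snd e" ?N] by auto
  qed
  then have "R \<times> R \<subseteq> conn ?N" using conn_least G(2) by blast
  then show thesis using that f(1) by blast
qed

definition component :: "'f set \<Rightarrow> 'v \<Rightarrow> 'v set" where
  "component G s = {t \<in> R. (s, t) \<in> conn (p ` G)}"

lemma component_eq_iff:
  assumes "s \<in> R" "t \<in> R"
  shows "component G s = component G t \<longleftrightarrow> (s, t) \<in> conn (p ` G)"
proof
  assume "component G s = component G t"
  then show "(s, t) \<in> conn (p ` G)" using assms unfolding component_def using conn_refl[of t] conn_sym by blast
next
  assume "(s, t) \<in> conn (p ` G)"
  then show "component G s = component G t"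
    unfolding component_def using conn_trans[of s t] conn_trans[OF conn_sym, of s t] by blast
qed

text \<open>Deleting an irredundant link splits a component: the map \<open>g\<close> from the finer
  to the coarser components is onto, but identifies those of the two ends of
  \<open>h\<close>.\<close>

lemma card_components:
  assumes "H \<subseteq> F"
  shows "card H + 1 \<le> card (component (F - H) ` R)"
proof -
  have "finite H" using assms finite_F finite_subset by blast
  then show ?thesis using assms
  proof (induction H rule: finite_induct)
    case empty
    have "component F ` R \<noteq> {}" using R_nonempty by blast
    then show ?case using finite_R by (simp add: Suc_leI card_gt_0_iff)
  next
    case (insert h H)
    let ?A = "F - insert h H" and ?B = "F - H"
    obtain a b where ab: "p h = (a, b)" by fastforce
    have R: "a \<in> R" "b \<in> R" using ab ends insert.prems by force+
    have "(a, b) \<notin> conn (p ` ?A)"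
      using irredundant[of h] conn_mono[of "p ` ?A" "p ` (F - {h})"] ab insert.prems by auto
    then have neA: "component ?A a \<noteq> component ?A b" using component_eq_iff R by simp
    have "(a, b) \<in> conn (p ` ?B)"
      using conn_base[of a b "p ` ?B"] ab insert by (metis DiffI image_eqI insert_subset)
    then have eqB: "component ?B a = component ?B b" using component_eq_iff R by simp
    define g where "g C = component ?B (SOME s. s \<in> R \<and> component ?A s = C)" for C
    have g: "g (component ?A s) = component ?B s" if "s \<in> R" for s
    proof -
      let ?s = "SOME s'. s' \<in> R \<and> component ?A s' = component ?A s"
      have "?s \<in> R \<and> component ?A ?s = component ?A s" using that by (rule_tac someI) simp
      moreover from this have "(?s, s) \<in> conn (p ` ?A)" using component_eq_iff that by blast
      then have "(?s, s) \<in> conn (p ` ?B)" using conn_mono[of "p ` ?A" "p ` ?B"] by blast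
      ultimately show ?thesis unfolding g_def using component_eq_iff that by blast
    qed
    have "g ` component ?A ` R = component ?B ` R"
      unfolding image_image using g by (intro image_cong) auto
    moreover have "\<not> inj_on g (component ?A ` R)"
      using g[OF R(1)] g[OF R(2)] eqB neA R unfolding inj_on_def by (metis imageI)
    then have "card (g ` component ?A ` R) \<noteq> card (component ?A ` R)"
      using inj_on_iff_eq_card[of "component ?A ` R" g] finite_R by simp
    moreover have "card (g ` component ?A ` R) \<le> card (component ?A ` R)"
      using finite_R by (intro card_image_le) simp
    ultimately have "card (component ?B ` R) < card (component ?A ` R)" by simp
    then show ?case using insert by simp
  qed
qed

text \<open>The extra 1 will account for the cluster of the root, which gets no moat.\<close>

lemma card_heavy_le:
  assumes "0 \<le> \<theta>"
  shows "card {f \<in> F. \<theta> < w f} + 1 \<le> card ((\<lambda>s. {t \<in> R. D s t \<le> \<theta>}) ` R)"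
proof -
  have "F - {f \<in> F. \<theta> < w f} = below \<theta>" unfolding below_def by auto
  moreover have "component (below \<theta>) s = {t \<in> R. D s t \<le> \<theta>}" if "s \<in> R" for s
    unfolding component_def using D_le_iff that assms by blast
  ultimately show ?thesis using card_components[of "{f \<in> F. \<theta> < w f}"] by (simp cong: image_cong)
qed

end

section \<open>Connections by stars of minimum potential\<close>

text \<open>\<open>Star v h p q\<close> connects the terminals \<open>h\<close>, \<open>p\<close>, \<open>q\<close> via the centre \<open>v\<close>.\<close>
datatype 'v component_item = Direct 'v 'v | Star 'v 'v 'v 'v

fun links :: "'v component_item \<Rightarrow> ('v \<times> 'v) set" where
  "links (Direct s t) = {(s, t)}"
| "links (Star v h p q) = {(h, p), (h, q)}"

text \<open>A star losing one of its two links is replaced by the direct connection that remains.\<close>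
fun keep :: "'v component_item \<Rightarrow> ('v \<times> 'v) set \<Rightarrow> 'v component_item set" where
  "keep (Direct s t) K = (if (s, t) \<in> K then {Direct s t} else {})"
| "keep (Star v h p q) K =
    (if (h, p) \<in> K then if (h, q) \<in> K then {Star v h p q} else {Direct h p}
     else if (h, q) \<in> K then {Direct h q} else {})"

lemma finite_links: "finite (links i)"
  by (cases i) auto

lemma finite_keep: "finite (keep i K)"
  by (cases i) auto

lemma links_keep: "K \<subseteq> links i \<Longrightarrow> K \<subseteq> (\<Union>j\<in>keep i K. links j)"
  by (cases i) auto

context steiner_instance
begin

fun valid :: "'v component_item \<Rightarrow> bool" where
  "valid (Direct s t) \<longleftrightarrow> s \<in> R \<and> t \<in> R \<and> s \<noteq> t"
| "valid (Star v h p q) \<longleftrightarrow> v \<in> V \<and> h \<in> R \<and> p \<in> R \<and> q \<in> R \<and> h \<noteq> p \<and> h \<noteq> q \<and> p \<noteq> q"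

text \<open>The links of a star share the leg of \<open>h\<close>, which survives the loss of one link. Charging
  harmonically, \<open>1 + 1/2\<close> times this leg enters the potential and one half of it the weight of each
  link, so the weights of all links add up to the cost, while removing links decreases the potential
  by at least their weight.\<close>
fun potential :: "'v component_item \<Rightarrow> real" where
  "potential (Direct s t) = distance s t"
| "potential (Star v h p q) = 3/2 * distance v h + distance v p + distance v q"

fun weight :: "'v component_item \<Rightarrow> 'v \<times> 'v \<Rightarrow> real" where
  "weight (Direct s t) e = distance s t"
| "weight (Star v h p q) e = distance v h / 2 + distance v (snd e)"

lemma R_V: "s \<in> R \<Longrightarrow> s \<in> V"
  using terminals_subset by blast

lemma valid_keep: "valid i \<Longrightarrow> j \<in> keep i K \<Longrightarrow> valid j"
  by (cases i) (auto split: if_splits)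

lemma potential_nonneg: "valid i \<Longrightarrow> 0 \<le> potential i"
  by (cases i) (auto intro!: add_nonneg_nonneg distance_nonneg R_V)

lemma weight_pos:
  assumes "valid i" "e \<in> links i"
  shows "0 < weight i e"
proof (cases i)
  case (Direct s t)
  then show ?thesis using assms by (auto intro: distance_pos R_V)
next
  case (Star v h p q)
  then have "snd e = p \<or> snd e = q" using assms by auto
  then have e: "v \<in> V" "h \<in> V" "snd e \<in> V" "snd e \<noteq> h" using Star assms R_V by auto
  then have "0 < distance v h \<or> 0 < distance v (snd e)" using distance_pos[of v h] distance_pos[of v "snd e"] by metis
  then show ?thesis using Star distance_nonneg[of v h] distance_nonneg[of v "snd e"] e by auto
qed

text \<open>If one link of a star goes, the triangle inequality through \<open>v\<close> bounds the
  remaining direct connection by exactly the right side. If both go, half of the leg of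
  \<open>h\<close> is left over.\<close>

lemma potential_keep:
  assumes "valid i" "K \<subseteq> links i"
  shows "sum potential (keep i K) \<le> potential i - sum (weight i) (links i - K)"
proof (cases i)
  case (Direct s t)
  then have "K = {} \<or> K = {(s, t)}" using assms by auto
  then show ?thesis using Direct by auto
next
  case (Star v h p q)
  then have V: "v \<in> V" "h \<in> V" "p \<in> V" "q \<in> V" and pq: "p \<noteq> q" using assms R_V by auto
  have "distance h p \<le> distance v h + distance v p" "distance h q \<le> distance v h + distance v q"
    using distance_triangle[of h v p] distance_triangle[of h v q] distance_sym[of h v] V by auto
  moreover have "0 \<le> distance v h" using distance_nonneg V by blast
  moreover have "links i - K = (if (h, p) \<in> K then {} else {(h, p)}) \<union> (if (h, q) \<in> K then {} else {(h, q)})"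
    using Star by auto
  ultimately show ?thesis using Star pq by auto
qed

text \<open>The two halves of the leg of \<open>h\<close> add up to the full leg, so the weights of
  a star pay for the union of its three cheapest legs.\<close>

lemma item_realization:
  assumes "valid i"
  obtains P where "P \<subseteq> E" "links i \<subseteq> (bidirected P)\<^sup>*" "sum c P \<le> sum (weight i) (links i)"
proof (cases i)
  case (Direct s t)
  then obtain P where "P \<subseteq> E" "(s, t) \<in> (bidirected P)\<^sup>*" "distance s t = sum c P"
    using distance_ex[of s t] assms R_V by auto
  then show thesis using that[of P] Direct by simp
next
  case (Star v h p q)
  then have V: "v \<in> V" "h \<in> V" "p \<in> V" "q \<in> V" and pq: "p \<noteq> q" using assms R_V by auto
  obtain A where A: "A \<subseteq> E" "(v, h) \<in> (bidirected A)\<^sup>*" "distance v h = sum c A"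
    using distance_ex V by blast
  obtain B where B: "B \<subseteq> E" "(v, p) \<in> (bidirected B)\<^sup>*" "distance v p = sum c B"
    using distance_ex V by blast
  obtain C where C: "C \<subseteq> E" "(v, q) \<in> (bidirected C)\<^sup>*" "distance v q = sum c C"
    using distance_ex V by blast
  let ?P = "A \<union> (B \<union> C)"
  have "(v, h) \<in> (bidirected ?P)\<^sup>*" "(v, p) \<in> (bidirected ?P)\<^sup>*" "(v, q) \<in> (bidirected ?P)\<^sup>*"
    using A(2) B(2) C(2) bidirected_mono[of A ?P] bidirected_mono[of B ?P] bidirected_mono[of C ?P] by auto
  then have "(h, p) \<in> (bidirected ?P)\<^sup>*" "(h, q) \<in> (bidirected ?P)\<^sup>*"
    by (auto intro: rtrancl_trans[OF bidirected_sym])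
  then have "links i \<subseteq> (bidirected ?P)\<^sup>*" using Star by simp
  moreover have "sum c ?P \<le> sum c A + (sum c B + sum c C)"
    using sum_cost_Un[OF A(1), of "B \<union> C"] sum_cost_Un[OF B(1) C(1)] B(1) C(1) by simp
  ultimately show thesis using that[of ?P] A B C Star pq by simp
qed

lemma finite_valid: "finite {i. valid i}"
proof (rule finite_subset)
  let ?X = "(\<lambda>(s, t). Direct s t) ` (V \<times> V) \<union> (\<lambda>((v, h), (p, q)). Star v h p q) ` ((V \<times> V) \<times> (V \<times> V))"
  show "{i. valid i} \<subseteq> ?X"
  proof
    fix i assume "i \<in> {i. valid i}"
    then show "i \<in> ?X"
    proof (cases i)
      case (Direct s t)
      then have "(s, t) \<in> V \<times> V" using \<open>i \<in> _\<close> R_V by auto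
      then show ?thesis using Direct by (intro UnI1 image_eqI[of _ _ "(s, t)"]) auto
    next
      case (Star v h p q)
      then have "((v, h), (p, q)) \<in> (V \<times> V) \<times> (V \<times> V)" using \<open>i \<in> _\<close> R_V by auto
      then show ?thesis using Star by (intro UnI2 image_eqI[of _ _ "((v, h), (p, q))"]) auto
    qed
  qed
  show "finite ?X" using finite_V by simp
qed

definition configuration :: "'v component_item set \<Rightarrow> bool" where
  "configuration S \<longleftrightarrow> S \<subseteq> {i. valid i} \<and> R \<times> R \<subseteq> conn (\<Union>i\<in>S. links i)"

text \<open>Links carry their item because several items may link the same pair with different
  weights.\<close>

definition tagged :: "'v component_item set \<Rightarrow> ('v component_item \<times> ('v \<times> 'v)) set" where
  "tagged S = Sigma S links"

lemma optimal_configuration: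
  obtains S where "configuration S" "\<And>S'. configuration S' \<Longrightarrow> sum potential S \<le> sum potential S'"
proof -
  have fin: "finite (Collect configuration)"
    by (rule finite_subset[of _ "Pow {i. valid i}"]) (auto simp: configuration_def finite_valid)
  have "(s, t) \<in> conn (\<Union>i\<in>{i. valid i}. links i)" if "s \<in> R" "t \<in> R" for s t
  proof (cases "s = t")
    case False
    then have "(s, t) \<in> (\<Union>i\<in>{i. valid i}. links i)"
      using that by (intro UN_I[of "Direct s t"]) auto
    then show ?thesis by (rule conn_base)
  qed simp
  then have "configuration {i. valid i}" unfolding configuration_def by auto
  then show thesis
    using ex_is_arg_min_if_finite[OF fin, of "sum potential"] that unfolding is_arg_min_linorder by blast
qed

text \<open>Applying \<open>keep\<close> to all items discards the links outside \<open>Y\<close>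
  and lowers the potential by at least their weight; the items of \<open>N\<close> restore
  connectivity. Coinciding items can only lower the sum, as potentials are nonnegative.\<close>

lemma restrict_configuration:
  assumes S: "configuration S" and Y: "Y \<subseteq> tagged S" and N: "N \<subseteq> {i. valid i}"
    and conn: "R \<times> R \<subseteq> conn ((\<Union>i\<in>N. links i) \<union> snd ` Y)"
  obtains S' where "configuration S'"
    "sum potential S' \<le> sum potential N + sum potential S - (\<Sum>f\<in>tagged S - Y. weight (fst f) (snd f))"
proof -
  have vS: "S \<subseteq> {i. valid i}" using S unfolding configuration_def by blast
  then have fS: "finite S" and fN: "finite N" using N finite_valid finite_subset by blast+
  define K where "K i = {e. (i, e) \<in> Y}" for i
  have K: "K i \<subseteq> links i" if "i \<in> S" for i using Y that unfolding K_def tagged_def by auto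
  define S' where "S' = N \<union> (\<Union>i\<in>S. keep i (K i))"
  have "S' \<subseteq> {i. valid i}" unfolding S'_def using vS N valid_keep by blast
  moreover have "(\<Union>i\<in>N. links i) \<union> snd ` Y \<subseteq> (\<Union>i\<in>S'. links i)"
  proof -
    have "snd f \<in> (\<Union>i\<in>S'. links i)" if "f \<in> Y" for f
    proof -
      have "fst f \<in> S" "snd f \<in> K (fst f)" using Y that unfolding K_def tagged_def by auto
      then show ?thesis using links_keep[OF K] unfolding S'_def by blast
    qed
    then show ?thesis unfolding S'_def by blast
  qed
  then have "conn ((\<Union>i\<in>N. links i) \<union> snd ` Y) \<subseteq> conn (\<Union>i\<in>S'. links i)" by (rule conn_mono)
  then have "R \<times> R \<subseteq> conn (\<Union>i\<in>S'. links i)" using conn by (rule order_trans[rotated])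
  ultimately have "configuration S'" unfolding configuration_def by blast
  have pos: "0 \<le> potential i" if "i \<in> S'" for i
    using that \<open>S' \<subseteq> {i. valid i}\<close> potential_nonneg by blast
  have "sum potential S' \<le> sum potential N + sum potential (\<Union>i\<in>S. keep i (K i))"
    using pos fN fS unfolding S'_def by (intro sum_Un_le) (auto simp: finite_keep)
  also have "sum potential (\<Union>i\<in>S. keep i (K i)) \<le> (\<Sum>i\<in>S. sum potential (keep i (K i)))"
    using pos fS by (intro sum_UN_le) (auto simp: finite_keep S'_def)
  also have "\<dots> \<le> (\<Sum>i\<in>S. potential i - sum (weight i) (links i - K i))"
    using potential_keep K vS by (intro sum_mono) blast
  also have "\<dots> = sum potential S - (\<Sum>i\<in>S. sum (weight i) (links i - K i))"
    by (simp add: sum_subtractf)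
  also have "(\<Sum>i\<in>S. sum (weight i) (links i - K i)) = (\<Sum>f\<in>tagged S - Y. weight (fst f) (snd f))"
  proof -
    have "tagged S - Y = Sigma S (\<lambda>i. links i - K i)" unfolding tagged_def K_def by auto
    then show ?thesis using fS by (simp add: sum.Sigma finite_links split_def)
  qed
  finally show thesis using that \<open>configuration S'\<close> by simp
qed

text \<open>By minimality, the links that new items make dispensable weigh at most the potential of
  these items. No new item gives irredundance; a direct connection and a star give the two exchange
  inequalities.\<close>

lemma link_structure:
  obtains F :: "('v component_item \<times> ('v \<times> 'v)) set" and w where
    "link_tree R F snd w" "steiner_opt V E c R \<le> sum w F"
    "\<And>s t Y. s \<in> R \<Longrightarrow> t \<in> R \<Longrightarrow> Y \<subseteq> F \<Longrightarrow> R \<times> R \<subseteq> conn (insert (s, t) (snd ` Y)) \<Longrightarrow>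
      s \<noteq> t \<Longrightarrow> sum w (F - Y) \<le> distance s t"
    "\<And>v s t j Y. v \<in> V \<Longrightarrow> s \<in> R \<Longrightarrow> t \<in> R \<Longrightarrow> j \<in> R \<Longrightarrow> s \<noteq> t \<Longrightarrow> s \<noteq> j \<Longrightarrow> t \<noteq> j \<Longrightarrow> Y \<subseteq> F \<Longrightarrow>
      R \<times> R \<subseteq> conn (insert (s, t) (insert (s, j) (snd ` Y))) \<Longrightarrow>
      sum w (F - Y) \<le> 3/2 * distance v s + distance v t + distance v j"
proof -
  obtain S where S: "configuration S" and opt: "\<And>S'. configuration S' \<Longrightarrow> sum potential S \<le> sum potential S'"
    using optimal_configuration by blast
  define w where "w f = weight (fst f) (snd f)" for f
  have vS: "S \<subseteq> {i. valid i}" using S unfolding configuration_def by blast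
  then have fS: "finite S" using finite_valid finite_subset by blast
  have exch: "sum w (tagged S - Y) \<le> sum potential N"
    if Y: "Y \<subseteq> tagged S" "N \<subseteq> {i. valid i}" "R \<times> R \<subseteq> conn ((\<Union>i\<in>N. links i) \<union> snd ` Y)" for Y N
  proof -
    obtain S' where "configuration S'"
      "sum potential S' \<le> sum potential N + sum potential S - (\<Sum>f\<in>tagged S - Y. weight (fst f) (snd f))"
      using restrict_configuration[OF S Y] by blast
    then show ?thesis using opt[of S'] unfolding w_def by simp
  qed
  have snd_tagged: "snd ` tagged S = (\<Union>i\<in>S. links i)" unfolding tagged_def by force
  have conn_S: "R \<times> R \<subseteq> conn (snd ` tagged S)" using S unfolding configuration_def snd_tagged by blast
  have fin: "finite (tagged S)" unfolding tagged_def using fS finite_links by blast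
  have w_pos: "0 < w f" if "f \<in> tagged S" for f
    using that weight_pos vS unfolding tagged_def w_def by auto
  have ends: "snd ` tagged S \<subseteq> R \<times> R"
  proof -
    have "links i \<subseteq> R \<times> R" if "valid i" for i using that by (cases i) auto
    then show ?thesis unfolding snd_tagged using vS by blast
  qed
  have tree: "link_tree R (tagged S) snd w"
  proof
    show "finite R" "R \<noteq> {}" "finite (tagged S)" "snd ` tagged S \<subseteq> R \<times> R" "R \<times> R \<subseteq> conn (snd ` tagged S)"
      using finite_R terminals_nonempty fin ends conn_S by blast+
    fix f assume f: "f \<in> tagged S"
    show "0 < w f" using w_pos f .
    show "snd f \<notin> conn (snd ` (tagged S - {f}))"
    proof
      assume sf: "snd f \<in> conn (snd ` (tagged S - {f}))"
      have "snd ` tagged S \<subseteq> conn (snd ` (tagged S - {f}))"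
      proof
        fix e assume "e \<in> snd ` tagged S"
        then have "e = snd f \<or> e \<in> snd ` (tagged S - {f})" by blast
        then show "e \<in> conn (snd ` (tagged S - {f}))"
          using sf conn_base[of "fst e" "snd e" "snd ` (tagged S - {f})"] by auto
      qed
      then have "R \<times> R \<subseteq> conn (snd ` (tagged S - {f}))" using conn_least conn_S by blast
      then have "sum w (tagged S - (tagged S - {f})) \<le> sum potential {}" by (intro exch) auto
      moreover have "tagged S - (tagged S - {f}) = {f}" using f by blast
      ultimately show False using w_pos[OF f] by simp
    qed
  qed
  have cost: "steiner_opt V E c R \<le> sum w (tagged S)"
  proof -
    have "\<forall>i\<in>S. \<exists>P. P \<subseteq> E \<and> links i \<subseteq> (bidirected P)\<^sup>* \<and> sum c P \<le> sum (weight i) (links i)"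
    proof
      fix i assume "i \<in> S"
      then have "valid i" using vS by blast
      then show "\<exists>P. P \<subseteq> E \<and> links i \<subseteq> (bidirected P)\<^sup>* \<and> sum c P \<le> sum (weight i) (links i)"
        by (rule item_realization) (intro exI conjI)
    qed
    from bchoice[OF this] obtain P where P: "\<And>i. i \<in> S \<Longrightarrow> P i \<subseteq> E"
      "\<And>i. i \<in> S \<Longrightarrow> links i \<subseteq> (bidirected (P i))\<^sup>*"
      "\<And>i. i \<in> S \<Longrightarrow> sum c (P i) \<le> sum (weight i) (links i)" by auto
    let ?P = "\<Union>i\<in>S. P i"
    have "(\<Union>i\<in>S. links i) \<subseteq> (bidirected ?P)\<^sup>*"
    proof
      fix e assume "e \<in> (\<Union>i\<in>S. links i)"
      then obtain i where "i \<in> S" "e \<in> links i" by blast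
      then show "e \<in> (bidirected ?P)\<^sup>*" using P(2) bidirected_mono[of "P i" ?P] by blast
    qed
    then have "(\<Union>i\<in>S. links i) \<union> (\<Union>i\<in>S. links i)\<inverse> \<subseteq> (bidirected ?P)\<^sup>*"
      by (auto intro: bidirected_sym)
    then have "conn (\<Union>i\<in>S. links i) \<subseteq> (bidirected ?P)\<^sup>*"
      unfolding conn_def by (rule rtrancl_subset_rtrancl)
    then have "R \<times> R \<subseteq> (bidirected ?P)\<^sup>*" using conn_S unfolding snd_tagged by blast
    then have "steiner_opt V E c R \<le> sum c ?P" using P(1) by (intro steiner_opt_le) auto
    also have "\<dots> \<le> (\<Sum>i\<in>S. sum c (P i))" using fS P(1) by (rule sum_cost_UN)
    also have "\<dots> \<le> (\<Sum>i\<in>S. sum (weight i) (links i))" using P(3) by (rule sum_mono)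
    also have "\<dots> = sum w (tagged S)"
      unfolding tagged_def w_def using fS by (simp add: sum.Sigma finite_links split_def)
    finally show ?thesis .
  qed
  have pair: "sum w (tagged S - Y) \<le> distance s t"
    if "s \<in> R" "t \<in> R" "Y \<subseteq> tagged S" "R \<times> R \<subseteq> conn (insert (s, t) (snd ` Y))" "s \<noteq> t" for s t Y
    using exch[of Y "{Direct s t}"] that by simp
  have star: "sum w (tagged S - Y) \<le> 3/2 * distance v s + distance v t + distance v j"
    if "v \<in> V" "s \<in> R" "t \<in> R" "j \<in> R" "s \<noteq> t" "s \<noteq> j" "t \<noteq> j" "Y \<subseteq> tagged S"
      "R \<times> R \<subseteq> conn (insert (s, t) (insert (s, j) (snd ` Y)))" for v s t j Y
    using exch[of Y "{Star v s t j}"] that by simp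
  show thesis by (rule that[of "tagged S" w]) (fact tree cost pair star)+
qed

end

section \<open>The dual solution\<close>

context steiner_instance
begin

text \<open>A new direct connection displaces a link of weight at least \<open>D s t\<close>; a new
  star displaces two, of weights at least \<open>D s t\<close> and \<open>D s j\<close>.\<close>

lemma bottleneck_structure:
  obtains F :: "('v component_item \<times> ('v \<times> 'v)) set" and w D where
    "terminal_ultrametric R D" "finite F" "\<And>f. f \<in> F \<Longrightarrow> 0 < w f" "steiner_opt V E c R \<le> sum w F"
    "\<And>s t. s \<in> R \<Longrightarrow> t \<in> R \<Longrightarrow> D s t \<le> distance s t"
    "\<And>v s t j. v \<in> V \<Longrightarrow> s \<in> R \<Longrightarrow> t \<in> R \<Longrightarrow> j \<in> R \<Longrightarrow> D s j \<le> D t j \<Longrightarrow>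
      D s t + D s j \<le> 3/2 * distance v s + distance v t + distance v j"
    "\<And>\<theta>. 0 \<le> \<theta> \<Longrightarrow> card {f \<in> F. \<theta> < w f} + 1 \<le> card ((\<lambda>s. {t \<in> R. D s t \<le> \<theta>}) ` R)"
proof (rule link_structure)
  fix F :: "('v component_item \<times> ('v \<times> 'v)) set" and w
  assume tree: "link_tree R F snd w" and cost: "steiner_opt V E c R \<le> sum w F" and
    pair: "\<And>s t Y. s \<in> R \<Longrightarrow> t \<in> R \<Longrightarrow> Y \<subseteq> F \<Longrightarrow> R \<times> R \<subseteq> conn (insert (s, t) (snd ` Y)) \<Longrightarrow>
      s \<noteq> t \<Longrightarrow> sum w (F - Y) \<le> distance s t" and
    star: "\<And>v s t j Y. v \<in> V \<Longrightarrow> s \<in> R \<Longrightarrow> t \<in> R \<Longrightarrow> j \<in> R \<Longrightarrow> s \<noteq> t \<Longrightarrow> s \<noteq> j \<Longrightarrow> t \<noteq> j \<Longrightarrow> Y \<subseteq> F \<Longrightarrow>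
      R \<times> R \<subseteq> conn (insert (s, t) (insert (s, j) (snd ` Y))) \<Longrightarrow>
      sum w (F - Y) \<le> 3/2 * distance v s + distance v t + distance v j"
  interpret link_tree R F snd w by (rule tree)
  have ultra: "terminal_ultrametric R D"
    by (unfold_locales; fact finite_R D_self D_sym D_ultra)
  have first: thesis' if "s \<in> R" "t \<in> R" "0 < D s t"
    and "\<And>f. f \<in> F \<Longrightarrow> D s t \<le> w f \<Longrightarrow> R \<times> R \<subseteq> conn (insert (s, t) (snd ` (F - {f}))) \<Longrightarrow> thesis'"
    for s t thesis'
    using heavy_exchange[of F "{}" s t "D s t"] connects not_conn_below[OF that(1-3)] that by auto
  have metric: "D s t \<le> distance s t" if st: "s \<in> R" "t \<in> R" for s t
  proof (cases "D s t = 0")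
    case True
    then show ?thesis using distance_nonneg st R_V by simp
  next
    case False
    then have pos: "0 < D s t" using D_nonneg st by (simp add: order_less_le)
    have ne: "s \<noteq> t" using False D_self st by blast
    show ?thesis
    proof (rule first[OF st pos])
      fix f assume f: "f \<in> F" "D s t \<le> w f" "R \<times> R \<subseteq> conn (insert (s, t) (snd ` (F - {f})))"
      have "sum w (F - (F - {f})) \<le> distance s t" using pair[OF st _ f(3) ne] by blast
      moreover have "F - (F - {f}) = {f}" using f by blast
      ultimately show ?thesis using f by simp
    qed
  qed
  have metric_star: "D s t \<le> distance v s + distance v t" if "v \<in> V" "s \<in> R" "t \<in> R" for v s t
    using metric[OF that(2,3)] distance_triangle[of s v t] distance_sym[of s v] that R_V by simp
  have triple: "D s t + D s j \<le> 3/2 * distance v s + distance v t + distance v j"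
    if v: "v \<in> V" and R: "s \<in> R" "t \<in> R" "j \<in> R" and le: "D s j \<le> D t j" for v s t j
  proof -
    have nn: "0 \<le> distance v s" "0 \<le> distance v t" "0 \<le> distance v j"
      using distance_nonneg v R R_V by blast+
    consider "D s j = 0" | "D s t = 0" | "0 < D s j" "0 < D s t"
      using D_nonneg R by (metis order_less_le)
    then show ?thesis
    proof cases
      case 1 then show ?thesis using metric_star[OF v R(1,2)] nn by simp
    next
      case 2 then show ?thesis using metric_star[OF v R(1,3)] nn by simp
    next
      case 3
      have ne: "s \<noteq> t" "s \<noteq> j" "t \<noteq> j" using 3 le D_self R by auto
      show ?thesis
      proof (rule first[OF R(1,2) 3(2)])
        fix f assume f: "f \<in> F" "D s t \<le> w f" "R \<times> R \<subseteq> conn (insert (s, t) (snd ` (F - {f})))"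
        let ?G = "F - {f}"
        \<comment> \<open>With \<open>(s, t)\<close> inserted, links lighter than
          \<open>D s j\<close> might also reach \<open>j\<close> from \<open>t\<close>; the
          assumption \<open>D s j \<le> D t j\<close> excludes this.\<close>
        have "(s, j) \<notin> conn ({(s, t)} \<union> snd ` {g \<in> ?G. w g < D s j})"
        proof
          assume "(s, j) \<in> conn ({(s, t)} \<union> snd ` {g \<in> ?G. w g < D s j})"
          then have "(s, j) \<in> conn (snd ` {g \<in> ?G. w g < D s j}) \<or> (t, j) \<in> conn (snd ` {g \<in> ?G. w g < D s j})"
            using conn_insert_cases[of s j s t "snd ` {g \<in> ?G. w g < D s j}"] by auto
          moreover have "conn (snd ` {g \<in> ?G. w g < D s j}) \<subseteq> conn (snd ` {g \<in> F. w g < D s j})"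
            by (intro conn_mono image_mono) blast
          ultimately show False
            using not_conn_below[OF R(1,3) 3(1)] not_conn_below[OF R(2,3) 3(1) le] by blast
        qed
        then obtain g where g: "g \<in> ?G" "D s j \<le> w g"
          "R \<times> R \<subseteq> conn (insert (s, j) ({(s, t)} \<union> snd ` (?G - {g})))"
          using heavy_exchange[of ?G "{(s, t)}" s j "D s j"] f(3) R by auto
        have "insert (s, j) ({(s, t)} \<union> snd ` (?G - {g})) = insert (s, t) (insert (s, j) (snd ` (?G - {g})))" by blast
        then have "sum w (F - (?G - {g})) \<le> 3/2 * distance v s + distance v t + distance v j"
          using star[OF v R ne, of "?G - {g}"] g(3) by (metis Diff_subset order_trans)
        moreover have "F - (?G - {g}) = {f, g}" using f g by blast
        moreover have "sum w {f, g} = w f + w g" using g(1) by (subst sum.insert) auto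
        ultimately show ?thesis using f g by simp
      qed
    qed
  qed
  show thesis
    by (rule that[of D F w]) (fact ultra finite_F w_pos cost metric triple card_heavy_le)+
qed

end

text \<open>Integrating \<open>le\<close> over \<open>\<tau>\<close> turns the intervals into their
  lengths.\<close>

lemma interval_cover_sum:
  fixes x :: "'e \<Rightarrow> real" and y :: "'f \<Rightarrow> real"
  assumes fin: "finite A" "finite B" and y: "\<And>f. f \<in> A \<Longrightarrow> 0 \<le> y f"
    and lh: "\<And>e. e \<in> B \<Longrightarrow> l1 e \<le> h1 e" "\<And>e. e \<in> B \<Longrightarrow> l2 e \<le> h2 e"
    and le: "\<And>\<tau>. (\<Sum>f\<in>A. indicator {0..<y f} \<tau>) \<le> (\<Sum>e\<in>B. x e * (indicator {l1 e..<h1 e} \<tau> + indicator {l2 e..<h2 e} \<tau>))"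
  shows "sum y A \<le> (\<Sum>e\<in>B. x e * ((h1 e - l1 e) + (h2 e - l2 e)))"
proof -
  have int: "integrable lborel (indicator {a..<b} :: real \<Rightarrow> real)" for a b :: real
    using emeasure_bounded_finite[of "{a..<b}"] by (intro integrable_real_indicator) auto
  have val: "integral\<^sup>L lborel (indicator {a..<b}) = b - a" if "a \<le> b" for a b :: real
    using that by simp
  have "(\<integral>\<tau>. (\<Sum>f\<in>A. indicator {0..<y f} \<tau>) \<partial>lborel)
      \<le> (\<integral>\<tau>. (\<Sum>e\<in>B. x e * (indicator {l1 e..<h1 e} \<tau> + indicator {l2 e..<h2 e} \<tau>)) \<partial>lborel)"
    using le by (intro integral_mono Bochner_Integration.integrable_sum integrable_mult_right
        Bochner_Integration.integrable_add int) auto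
  also have "(\<integral>\<tau>. (\<Sum>f\<in>A. indicator {0..<y f} \<tau>) \<partial>lborel) = sum y A"
    using y int by (subst Bochner_Integration.integral_sum) (auto intro!: sum.cong simp: val)
  also have "(\<integral>\<tau>. (\<Sum>e\<in>B. x e * (indicator {l1 e..<h1 e} \<tau> + indicator {l2 e..<h2 e} \<tau>)) \<partial>lborel)
      = (\<Sum>e\<in>B. x e * ((h1 e - l1 e) + (h2 e - l2 e)))"
    using lh int
    by (subst Bochner_Integration.integral_sum)
      (auto intro!: sum.cong integrable_mult_right Bochner_Integration.integrable_add
        simp: val Bochner_Integration.integral_add)
  finally show ?thesis .
qed


context steiner_instance
begin

text \<open>Of the leg coefficients \<open>3/2\<close>, \<open>1\<close>, \<open>1\<close>, at least
  half in total belongs to legs leaving through the same end of the edge. Moving the centre there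
  shortens these legs by the distance moved and lengthens the others by at most as much.\<close>

lemma edge_point_admissible:
  assumes U: "terminal_ultrametric R D" and e: "(u, w) \<in> bidirected E"
    and star: "\<And>v s t j. v \<in> V \<Longrightarrow> s \<in> R \<Longrightarrow> t \<in> R \<Longrightarrow> j \<in> R \<Longrightarrow> D s j \<le> D t j \<Longrightarrow>
      D s t + D s j \<le> 3/2 * distance v s + distance v t + distance v j"
    and x: "0 \<le> x" "x \<le> c {u, w}"
  shows "terminal_ultrametric.admissible R D (\<lambda>v. min (distance u v + x) (distance w v + c {u, w} - x))"
proof -
  interpret terminal_ultrametric R D by (rule U)
  have V: "u \<in> V" "w \<in> V" using bidirected_vertices e by blast+
  have uw: "distance u w \<le> c {u, w}" using distance_edge e .
  have wu: "distance w u \<le> c {u, w}" using uw distance_sym V by simp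
  show ?thesis
    unfolding admissible_def
  proof (intro ballI impI)
    fix s t j assume stj: "s \<in> R" "t \<in> R" "j \<in> R" "D s j \<le> D t j"
    have close: "distance u q \<le> distance w q + c {u, w}" "distance w q \<le> distance u q + c {u, w}"
      if "q \<in> R" for q
      using distance_triangle[of u w q] distance_triangle[of w u q] uw wu V R_V[OF that] by auto
    have "D s t + D s j \<le> 3/2 * distance u s + distance u t + distance u j"
      "D s t + D s j \<le> 3/2 * distance w s + distance w t + distance w j"
      using star V stj by blast+
    moreover define f where "f v = min (distance u v + x) (distance w v + c {u, w} - x)" for v
    have f: "f q = distance u q + x \<or> f q = distance w q + c {u, w} - x" for q
      unfolding f_def by linarith
    ultimately have "D s t + D s j \<le> 3/2 * f s + f t + f j"
      using x close[OF stj(1)] close[OF stj(2)] close[OF stj(3)] f[of s] f[of t] f[of j]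
      by (elim disjE) linarith+
    then show "D s t + D s j \<le> 3/2 * min (distance u s + x) (distance w s + c {u, w} - x)
        + min (distance u t + x) (distance w t + c {u, w} - x) + min (distance u j + x) (distance w j + c {u, w} - x)"
      unfolding f_def .
  qed
qed

lemma out_cut_nonempty:
  assumes "S \<inter> R \<noteq> {}" "r \<in> R" "r \<notin> S"
  shows "out_cut E S \<noteq> {}"
proof -
  obtain s where s: "s \<in> S" "s \<in> R" using assms by blast
  have "(s, r) \<in> (bidirected E)\<^sup>*" using connected_V s assms R_V by blast
  then have "r \<in> S \<or> out_cut E S \<noteq> {}"
  proof (induction rule: rtrancl_induct)
    case (step y z)
    then show ?case unfolding out_cut_def by blast
  qed (use s in simp)
  then show ?thesis using assms by blast
qed

lemma finite_bidirected: "finite (bidirected E)"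
  using bidirected_vertices finite_V by (intro finite_subset[of "bidirected E" "V \<times> V"]) auto

text \<open>Weak duality, integrated over time: every moat without the root is crossed by at least
  one unit of \<open>x\<close>, and \<open>load_bound\<close> limits how long each edge is
  crossed.\<close>

lemma bcr_feasible_cost:
  assumes r: "r \<in> R" and x: "bcr_feasible V E R r x"
  shows "8/15 * steiner_opt V E c R \<le> (\<Sum>(u, v)\<in>bidirected E. c {u, v} * x (u, v))"
proof (rule bottleneck_structure)
  fix F :: "('v component_item \<times> ('v \<times> 'v)) set" and w D
  assume U: "terminal_ultrametric R D" and finF: "finite F" and w_pos: "\<And>f. f \<in> F \<Longrightarrow> 0 < w f"
    and cost: "steiner_opt V E c R \<le> sum w F"
    and metric: "\<And>s t. s \<in> R \<Longrightarrow> t \<in> R \<Longrightarrow> D s t \<le> distance s t"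
    and star: "\<And>v s t j. v \<in> V \<Longrightarrow> s \<in> R \<Longrightarrow> t \<in> R \<Longrightarrow> j \<in> R \<Longrightarrow> D s j \<le> D t j \<Longrightarrow>
      D s t + D s j \<le> 3/2 * distance v s + distance v t + distance v j"
    and heavy: "\<And>\<theta>. 0 \<le> \<theta> \<Longrightarrow> card {f \<in> F. \<theta> < w f} + 1 \<le> card ((\<lambda>s. {t \<in> R. D s t \<le> \<theta>}) ` R)"
  interpret U: terminal_ultrametric R D by (rule U)
  let ?B = "bidirected E"
  have x_nonneg: "0 \<le> x e" if "e \<in> ?B" for e using x that unfolding bcr_feasible_def by blast
  define load where "load e \<tau> C \<longleftrightarrow> U.loads (distance (fst e)) (distance (snd e)) \<tau> C" for e \<tau> C
  define covered where "covered e l1 h1 l2 h2 \<longleftrightarrow> l1 \<le> h1 \<and> l2 \<le> h2 \<and> (h1 - l1) + (h2 - l2) \<le> c {fst e, snd e} \<and>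
    (\<forall>\<tau>\<ge>0. real (card {C. load e \<tau> C}) \<le> indicator {l1..<h1} \<tau> + indicator {l2..<h2} \<tau>)" for e l1 h1 l2 h2
  have "\<exists>l1 h1 l2 h2. covered e l1 h1 l2 h2" if "e \<in> ?B" for e
  proof -
    obtain u v where e: "e = (u, v)" by fastforce
    have uv: "(u, v) \<in> ?B" "u \<in> V" "v \<in> V" using that bidirected_vertices e by blast+
    let ?c = "c {u, v}"
    \<comment> \<open>A path from the point at position \<open>\<xi>\<close> leaves the edge through
      one of its ends.\<close>
    let ?F = "\<lambda>\<xi> t. min (distance u t + \<xi>) (distance v t + ?c - \<xi>)"
    have c: "distance u v \<le> ?c" using distance_edge uv by blast
    interpret S: terminal_segment R D ?F ?c
    proof
      show "0 \<le> ?c" using c distance_nonneg[of u v] uv by simp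
      show "U.admissible (?F y)" if "0 \<le> y" "y \<le> ?c" for y
        using edge_point_admissible[OF U uv(1) star that] by blast
    qed (auto simp: min_def)
    have ends: "?F 0 t = distance u t" "?F ?c t = distance v t" if "t \<in> R" for t
      using c distance_triangle[of u v t] distance_triangle[of v u t] distance_sym[of u v] uv R_V[OF that]
      by (auto simp: min_def)
    have "load e \<tau> C \<longleftrightarrow> U.loads (?F 0) (?F ?c) \<tau> C" if "0 \<le> \<tau>" for \<tau> C
    proof (cases "C \<in> (\<lambda>s. U.ball s \<tau>) ` R")
      case True
      then have "U.cluster C" using U.cluster_ball that by blast
      then have "U.first_arrival (?F 0) C = U.first_arrival (distance u) C"
        "U.first_arrival (?F ?c) C = U.first_arrival (distance v) C"
        using U.first_arrival_cong[of C "?F 0" "distance u"] U.first_arrival_cong[of C "?F ?c" "distance v"] ends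
        by blast+
      then show ?thesis unfolding load_def U.loads_def e by simp
    next
      case False
      then show ?thesis unfolding load_def U.loads_def by blast
    qed
    then have eq: "{C. load e \<tau> C} = {C. U.loads (?F 0) (?F ?c) \<tau> C}" if "0 \<le> \<tau>" for \<tau>
      using that by blast
    show ?thesis
    proof (rule S.load_bound)
      fix l1 h1 l2 h2
      assume "l1 \<le> h1" "l2 \<le> h2" "(h1 - l1) + (h2 - l2) \<le> ?c"
        "\<And>\<tau>. 0 \<le> \<tau> \<Longrightarrow> real (card {C. U.loads (?F 0) (?F ?c) \<tau> C}) \<le> indicator {l1..<h1} \<tau> + indicator {l2..<h2} \<tau>"
      then have "covered e l1 h1 l2 h2" unfolding covered_def using eq e by simp
      then show ?thesis by blast
    qed
  qed
  then obtain l1 h1 l2 h2 where cov: "\<And>e. e \<in> ?B \<Longrightarrow> covered e (l1 e) (h1 e) (l2 e) (h2 e)" by metis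
  have "(\<Sum>f\<in>F. 8/15 * w f) \<le> (\<Sum>e\<in>?B. x e * ((h1 e - l1 e) + (h2 e - l2 e)))"
  proof (rule interval_cover_sum[OF finF finite_bidirected])
    show "0 \<le> 8/15 * w f" if "f \<in> F" for f using w_pos[OF that] by simp
    show "l1 e \<le> h1 e" "l2 e \<le> h2 e" if "e \<in> ?B" for e using cov[OF that] unfolding covered_def by blast+
    fix \<tau> :: real
    let ?I = "\<lambda>e. indicator {l1 e..<h1 e} \<tau> + indicator {l2 e..<h2 e} \<tau> :: real"
    show "(\<Sum>f\<in>F. indicator {0..<8/15 * w f} \<tau>) \<le> (\<Sum>e\<in>?B. x e * ?I e)"
    proof (cases "0 \<le> \<tau>")
      case False
      then have "(\<Sum>f\<in>F. indicator {0..<8/15 * w f} \<tau> :: real) = 0" by (intro sum.neutral) auto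
      moreover have "0 \<le> (\<Sum>e\<in>?B. x e * ?I e)" using x_nonneg by (intro sum_nonneg mult_nonneg_nonneg) auto
      ultimately show ?thesis by simp
    next
      case True
      define Q where "Q = (\<lambda>s. U.ball s \<tau>) ` R"
      define Q' where "Q' = {C \<in> Q. r \<notin> C}"
      define moat where "moat C = {v \<in> V. U.first_arrival (distance v) C \<le> \<tau>}" for C
      have finQ: "finite Q" unfolding Q_def using finite_R by simp
      have "Q - Q' = {U.ball r \<tau>}"
      proof (intro equalityI subsetI)
        fix C assume "C \<in> Q - Q'"
        then obtain s where "s \<in> R" "C = U.ball s \<tau>" "r \<in> C" unfolding Q'_def Q_def by blast
        then show "C \<in> {U.ball r \<tau>}" using U.ball_eq[of s r \<tau>] by simp
      qed (use U.center_in_ball[OF r True] r in \<open>auto simp: Q'_def Q_def\<close>)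
      then have "card Q = card Q' + 1"
      proof -
        have "Q' \<subseteq> Q" unfolding Q'_def by blast
        then have "card (Q - Q') = card Q - card Q'" "card Q' \<le> card Q"
          using finQ by (auto intro: card_Diff_subset card_mono finite_subset)
        then show ?thesis using \<open>Q - Q' = {U.ball r \<tau>}\<close> by simp
      qed
      moreover have "Q = (\<lambda>s. {t \<in> R. D s t \<le> 15/8 * \<tau>}) ` R"
        unfolding Q_def U.ball_def by (intro image_cong) auto
      ultimately have cardQ: "card {f \<in> F. 15/8 * \<tau> < w f} \<le> card Q'"
        using heavy[of "15/8 * \<tau>"] True by simp
      have moat_cut: "1 \<le> (\<Sum>e\<in>out_cut E (moat C). x e)" if C: "C \<in> Q'" for C
      proof -
        have cl: "U.cluster C" using C U.cluster_ball True unfolding Q'_def Q_def by blast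
        obtain s where s: "s \<in> R" "C = U.ball s \<tau>" using C unfolding Q'_def Q_def by blast
        then have sC: "s \<in> C" using U.center_in_ball True by blast
        \<comment> \<open>As \<open>D\<close> is at most the distance, every term is nonpositive: a
          terminal lies in its own moat from time 0 on.\<close>
        have "U.arrival (distance s) s \<le> 0"
          using metric[OF s(1)] distance_self[OF R_V[OF s(1)]] by (intro U.arrival_le[OF s(1)]) simp
        then have "s \<in> moat C"
          unfolding moat_def using U.first_arrival_le[OF cl sC, of "distance s"] True R_V[OF s(1)] by simp
        moreover have "r \<notin> moat C"
        proof -
          obtain t where t: "t \<in> C" "U.first_arrival (distance r) C = U.arrival (distance r) t"
            using U.first_arrival_ex[OF cl] by blast
          then have tR: "t \<in> R" using cl unfolding U.cluster_def by blast
          have "r \<notin> U.ball t \<tau>" using C t s U.ball_eq unfolding Q'_def by blast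
          then have "\<tau> < 8/15 * D t r" using r unfolding U.ball_def by simp
          moreover have "D t r \<le> distance r t" using metric[OF tR r] distance_sym[of r t] R_V r tR by simp
          \<comment> \<open>The term against \<open>r\<close> is at least
            \<open>(3 * D t r + D t r) / 4 = D t r\<close>, which exceeds
            \<open>\<tau>\<close>.\<close>
          ultimately have "\<tau> < U.arrival (distance r) t"
            using U.arrival_ge[OF r, of "distance r" t] distance_self[OF R_V[OF r]] True by simp
          then show ?thesis unfolding moat_def using t by simp
        qed
        ultimately have "moat C \<subseteq> V - {r} \<and> moat C \<inter> R \<noteq> {}" using s(1) unfolding moat_def by blast
        then show ?thesis using x unfolding bcr_feasible_def by simp
      qed
      have "(\<Sum>f\<in>F. indicator {0..<8/15 * w f} \<tau>) = real (card {f \<in> F. 15/8 * \<tau> < w f})"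
      proof -
        have "(\<Sum>f\<in>F. indicator {0..<8/15 * w f} \<tau> :: real) = (\<Sum>f\<in>F. of_bool (15/8 * \<tau> < w f))"
          using True by (intro sum.cong) (auto simp: indicator_def)
        then show ?thesis using finF by (simp add: sum_of_bool_eq Int_def)
      qed
      also have "\<dots> \<le> real (card Q')" using cardQ by simp
      also have "\<dots> \<le> (\<Sum>C\<in>Q'. \<Sum>e\<in>out_cut E (moat C). x e)"
        using sum_mono[of Q' "\<lambda>_. 1" "\<lambda>C. \<Sum>e\<in>out_cut E (moat C). x e"] moat_cut by simp
      also have "\<dots> = (\<Sum>C\<in>Q'. \<Sum>e\<in>?B. if e \<in> out_cut E (moat C) then x e else 0)"
      proof (rule sum.cong[OF refl])
        fix C
        have "out_cut E (moat C) = {e \<in> ?B. e \<in> out_cut E (moat C)}" unfolding out_cut_def by blast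
        then show "(\<Sum>e\<in>out_cut E (moat C). x e) = (\<Sum>e\<in>?B. if e \<in> out_cut E (moat C) then x e else 0)"
          using sum.inter_filter[OF finite_bidirected, of x "\<lambda>e. e \<in> out_cut E (moat C)"] by simp
      qed
      also have "\<dots> = (\<Sum>e\<in>?B. \<Sum>C\<in>Q'. if e \<in> out_cut E (moat C) then x e else 0)"
        by (rule sum.swap)
      also have "\<dots> \<le> (\<Sum>e\<in>?B. x e * ?I e)"
      proof (rule sum_mono)
        fix e assume e: "e \<in> ?B"
        have fin: "finite Q'" using finQ unfolding Q'_def by simp
        have "(\<Sum>C\<in>Q'. if e \<in> out_cut E (moat C) then x e else 0) = x e * real (card {C \<in> Q'. e \<in> out_cut E (moat C)})"
          using sum.inter_filter[OF fin, of "\<lambda>_. x e" "\<lambda>C. e \<in> out_cut E (moat C)"] by (simp add: mult.commute)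
        also have "\<dots> \<le> x e * real (card {C. load e \<tau> C})"
        proof -
          have "snd e \<in> V" using e bidirected_vertices[of "fst e" "snd e"] by simp
          then have "{C \<in> Q'. e \<in> out_cut E (moat C)} \<subseteq> {C. load e \<tau> C}"
            unfolding Q'_def Q_def out_cut_def moat_def load_def U.loads_def by auto
          moreover have "finite {C. load e \<tau> C}"
            by (rule finite_subset[OF _ finQ]) (auto simp: load_def U.loads_def Q_def)
          ultimately show ?thesis using x_nonneg[OF e] by (intro mult_left_mono) (simp_all add: card_mono)
        qed
        also have "\<dots> \<le> x e * ?I e"
          using cov[OF e] True x_nonneg[OF e] unfolding covered_def by (intro mult_left_mono) auto
        finally show "(\<Sum>C\<in>Q'. if e \<in> out_cut E (moat C) then x e else 0) \<le> x e * ?I e" .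
      qed
      finally show ?thesis .
    qed
  qed
  also have "\<dots> \<le> (\<Sum>e\<in>?B. x e * c {fst e, snd e})"
    using cov x_nonneg unfolding covered_def by (intro sum_mono mult_left_mono) auto
  also have "\<dots> = (\<Sum>(u, v)\<in>?B. c {u, v} * x (u, v))"
    by (intro sum.cong) (auto simp: mult.commute)
  finally have "8/15 * sum w F \<le> (\<Sum>(u, v)\<in>?B. c {u, v} * x (u, v))" unfolding sum_distrib_left .
  then show ?thesis using cost by linarith
qed

lemma steiner_opt_le_bcr:
  assumes r: "r \<in> R"
  shows "steiner_opt V E c R \<le> 15/8 * bcr V E c R r"
proof -
  let ?X = "{(\<Sum>(u, v)\<in>bidirected E. c {u, v} * x (u, v)) | x. bcr_feasible V E R r x}"
  \<comment> \<open>A lower bound passes to a real infimum only if the set is nonempty.\<close>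
  have "bcr_feasible V E R r (\<lambda>_. 1)"
    unfolding bcr_feasible_def
  proof (intro conjI allI impI ballI)
    fix S assume "S \<subseteq> V - {r} \<and> S \<inter> R \<noteq> {}"
    then have "out_cut E S \<noteq> {}" using out_cut_nonempty r by blast
    moreover have "finite (out_cut E S)"
      using finite_bidirected by (rule finite_subset[rotated]) (auto simp: out_cut_def)
    ultimately have "0 < card (out_cut E S)" by (simp add: card_gt_0_iff)
    then show "1 \<le> (\<Sum>e\<in>out_cut E S. 1 :: real)" by simp
  qed simp
  then have "?X \<noteq> {}" by blast
  then have "8/15 * steiner_opt V E c R \<le> Inf ?X"
    using bcr_feasible_cost[OF r] by (intro cInf_greatest) auto
  then show ?thesis unfolding bcr_def by simp
qed

end

theorem theorem1p1:
  shows "bcr_integrality_gap \<le> ereal 1.898 \<and>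
    (\<forall>(V :: 'v set) E c R r. steiner_instance V E c R \<and> r \<in> R \<longrightarrow>
       steiner_opt V E c R \<le> 1.898 * bcr V E c R r)"
proof
  \<comment> \<open>Here \<open>15/8 = 1.875\<close>, and the relaxation value is nonnegative
    because the optimum is.\<close>
  have bound: "0 \<le> steiner_opt V E c R \<and> 0 \<le> bcr V E c R r \<and> steiner_opt V E c R \<le> 1.898 * bcr V E c R r"
    if "steiner_instance V E c R" "r \<in> R" for V :: "nat set" and E c R r
    using steiner_instance.steiner_opt_le_bcr[OF that] steiner_instance.steiner_opt_nonneg[OF that(1)] by simp
  show "bcr_integrality_gap \<le> ereal 1.898"
    unfolding bcr_integrality_gap_def
  proof (rule Sup_least, clarify)
    fix V :: "nat set" and E c R r
    assume "steiner_instance V E c R" "r \<in> R"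
    then have b: "0 \<le> steiner_opt V E c R" "0 \<le> bcr V E c R r" "steiner_opt V E c R \<le> 1.898 * bcr V E c R r"
      using bound by blast+
    show "ereal (steiner_opt V E c R) / ereal (bcr V E c R r) \<le> ereal 1.898"
    proof (cases "bcr V E c R r = 0")
      \<comment> \<open>The bound forces the optimum to be 0 as well, and the extended real quotient
        \<open>0 / 0\<close> is 0.\<close>
      case True
      then have "steiner_opt V E c R = 0" using b by simp
      then show ?thesis using True by simp
    next
      case False
      then show ?thesis using b by (simp add: divide_le_eq)
    qed
  qed
  show "\<forall>(V :: 'v set) E c R r. steiner_instance V E c R \<and> r \<in> R \<longrightarrow>
       steiner_opt V E c R \<le> 1.898 * bcr V E c R r"
    using steiner_instance.steiner_opt_le_bcr steiner_instance.steiner_opt_nonneg by force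
qed

end
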